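(* Let $\omega:\mathbb{C}\to\mathbb{R}$ be a (smooth) solution of the sinh-Gordon equation $\Delta\omega+\sinh(\omega)\cosh(\omega)=0$. Let $\delta,\gamma\in\mathbb{S}^1$ be arbitrary but fixed, and for $\lambda\in\mathbb{S}^1$ let $F_\lambda(z)$ be the solution of $F_\lambda^{-1}dF_\lambda=\alpha(\omega)$, $F_\lambda(0)=\mathbb{1}$, where $$\alpha(\omega)=\frac14\begin{pmatrix}2\omega_z & i\lambda^{-1}\delta e^{\omega}\\ i\gamma e^{-\omega} & -2\omega_z\end{pmatrix}dz+\frac14\begin{pmatrix}-2\omega_{\bar z} & i\bar\gamma e^{-\omega}\\ i\lambda\bar\delta e^{\omega} & 2\omega_{\bar z}\end{pmatrix}d\bar z .$$ Then the map $$X_\lambda(z)=\bigl(F_\lambda(z)\,\sigma_3\,F_\lambda(z)^{-1},\ \mathrm{Re}(-i\sqrt{\gamma\delta\lambda^{-1}}\,z)\bigr),\qquad \lambda\in\mathbb{S}^1,$$ defines an associated family of conformal minimal immersions $X_\lambda:\mathbb{C}\to\mathbb{S}^2\times\mathbb{R}$ with metric $ds^2=\cosh^2(\omega)\,dz\otimes d\bar z$ and Hopf differential $Q=\tfrac14\,\gamma\,\delta\,\lambda^{-1}\,dz^2$.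
   Context: $\Delta=\partial_x^2+\partial_y^2$ with $z=x+iy$. Identify $\mathfrak{su}_2\cong\mathbb{R}^3$ with inner product $\langle X_1,X_2\rangle=-\frac12\mathrm{tr}(X_1X_2)$, so that $\mathbb{S}^2\subset\mathfrak{su}_2$ is the set of elements with $\sqrt{\det X}=1$; $\sigma_3=\begin{pmatrix}i&0\\0&-i\end{pmatrix}\in\mathbb{S}^2$. For a conformal minimal immersion $X=(G,h)$ into $\mathbb{S}^2\times\mathbb{R}$ (so $G$ is harmonic), the Hopf differential is $Q=\langle G_z,G_z\rangle\,dz^2$, where $\langle\cdot,\cdot\rangle$ is extended complex bilinearly. For each $\lambda$ a square root $\sqrt{\gamma\delta\lambda^{-1}}$ is fixed. "Associated family" refers to the family parameterized by $\lambda\in\mathbb{S}^1$ belonging to the same $\omega$. *)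

theory Defs
  imports "HOL-Analysis.Analysis"
begin

section \<open>Smooth functions and derivatives in the complex coordinate\<close>

definition dir_deriv :: "'a::real_normed_vector \<Rightarrow> ('a \<Rightarrow> 'b::real_normed_vector) \<Rightarrow> 'a \<Rightarrow> 'b"
  where "dir_deriv v f x = frechet_derivative f (at x) v"

text \<open>Class \<open>C^k\<close> on the whole space. In the step it suffices to consider directional derivatives,
  since all domains used below are finite-dimensional.\<close>

primrec k_smooth :: "nat \<Rightarrow> ('a::real_normed_vector \<Rightarrow> 'b::real_normed_vector) \<Rightarrow> bool" where
  "k_smooth 0 f \<longleftrightarrow> continuous_on UNIV f"
| "k_smooth (Suc k) f \<longleftrightarrow> (\<forall>x. f differentiable (at x)) \<and> (\<forall>v. k_smooth k (dir_deriv v f))"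

definition smooth :: "('a::real_normed_vector \<Rightarrow> 'b::real_normed_vector) \<Rightarrow> bool"
  where "smooth f \<longleftrightarrow> (\<forall>k. k_smooth k f)"

text \<open>With \<open>z = x + i y\<close>, the partial derivatives \<open>\<partial>_x\<close> and \<open>\<partial>_y\<close> are the derivatives in the
  directions \<open>1\<close> and \<open>\<i>\<close>.\<close>

definition laplacian :: "(complex \<Rightarrow> real) \<Rightarrow> complex \<Rightarrow> real"
  where "laplacian f z = dir_deriv 1 (dir_deriv 1 f) z + dir_deriv \<i> (dir_deriv \<i> f) z"

definition deriv_z :: "(complex \<Rightarrow> complex) \<Rightarrow> complex \<Rightarrow> complex"
  where "deriv_z f z = (dir_deriv 1 f z - \<i> * dir_deriv \<i> f z) / 2"

definition deriv_zbar :: "(complex \<Rightarrow> complex) \<Rightarrow> complex \<Rightarrow> complex"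
  where "deriv_zbar f z = (dir_deriv 1 f z + \<i> * dir_deriv \<i> f z) / 2"

definition sinh_Gordon :: "(complex \<Rightarrow> real) \<Rightarrow> bool"
  where "sinh_Gordon \<omega> \<longleftrightarrow> (\<forall>z. laplacian \<omega> z + sinh (\<omega> z) * cosh (\<omega> z) = 0)"

section \<open>The Lie algebra and the ambient space\<close>

type_synonym mat2 = "complex ^ 2 ^ 2"

definition mk_mat2 :: "complex \<Rightarrow> complex \<Rightarrow> complex \<Rightarrow> complex \<Rightarrow> mat2"
  where "mk_mat2 a b c d = vector [vector [a, b], vector [c, d]]"

definition cscale :: "complex \<Rightarrow> mat2 \<Rightarrow> mat2"
  where "cscale c A = map_matrix (\<lambda>x. c * x) A"

definition su2 :: "mat2 set"
  where "su2 = {A. map_matrix cnj (transpose A) = - A \<and> trace A = 0}"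

text \<open>Complex bilinear on all matrices. As \<open>su2\<close> is a real form of the trace-free matrices, this
  gives the complex bilinear extension of the inner product of \<open>su2\<close>, on which it is real-valued.
  It is not the library's inner product of the matrix type.\<close>

definition su2_form :: "mat2 \<Rightarrow> mat2 \<Rightarrow> complex"
  where "su2_form A B = - (1/2) * trace (A ** B)"

definition S2 :: "mat2 set"
  where "S2 = {A \<in> su2. csqrt (det A) = 1}"

definition sigma3 :: mat2
  where "sigma3 = mk_mat2 \<i> 0 0 (- \<i>)"

type_synonym ambient = "mat2 \<times> real"

definition S2xR :: "ambient set"
  where "S2xR = S2 \<times> UNIV"

text \<open>Only used for vectors in \<open>su2 \<times> UNIV\<close>, where \<open>su2_form\<close> is real.\<close>

definition ambient_inner :: "ambient \<Rightarrow> ambient \<Rightarrow> real"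
  where "ambient_inner V W = Re (su2_form (fst V) (fst W)) + snd V * snd W"

definition tangent_S2xR :: "ambient \<Rightarrow> ambient set"
  where "tangent_S2xR p = {V. fst V \<in> su2 \<and> su2_form (fst p) (fst V) = 0}"

section \<open>Surfaces in the product\<close>

definition immersion_S2xR :: "(complex \<Rightarrow> ambient) \<Rightarrow> bool"
  where "immersion_S2xR X \<longleftrightarrow>
    smooth X \<and> range X \<subseteq> S2xR \<and> (\<forall>z. inj (frechet_derivative X (at z)))"

definition first_form :: "(complex \<Rightarrow> ambient) \<Rightarrow> complex \<Rightarrow> complex \<Rightarrow> complex \<Rightarrow> real"
  where "first_form X z u v = ambient_inner (dir_deriv u X z) (dir_deriv v X z)"

definition conformal :: "(complex \<Rightarrow> ambient) \<Rightarrow> bool"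
  where "conformal X \<longleftrightarrow>
    (\<forall>z. \<exists>\<rho>>0. \<forall>u v. first_form X z u v = \<rho> * (u \<bullet> v))"

definition unit_normal :: "(complex \<Rightarrow> ambient) \<Rightarrow> complex \<Rightarrow> ambient \<Rightarrow> bool"
  where "unit_normal X z N \<longleftrightarrow> N \<in> tangent_S2xR (X z) \<and> ambient_inner N N = 1 \<and>
    (\<forall>u. ambient_inner (dir_deriv u X z) N = 0)"

text \<open>The Levi-Civita connection of the product is the tangential part of the flat derivative in
  \<open>su2 \<times> UNIV\<close>. Because \<open>N\<close> is tangent to the product, the projection can be omitted.\<close>

definition second_form :: "(complex \<Rightarrow> ambient) \<Rightarrow> complex \<Rightarrow> ambient \<Rightarrow> complex \<Rightarrow> complex \<Rightarrow> real"
  where "second_form X z N u v = ambient_inner (dir_deriv u (dir_deriv v X) z) N"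

definition mean_curvature :: "(complex \<Rightarrow> ambient) \<Rightarrow> complex \<Rightarrow> ambient \<Rightarrow> real"
  where "mean_curvature X z N =
    (let g = first_form X z; h = second_form X z N in
      (g \<i> \<i> * h 1 1 - 2 * g 1 \<i> * h 1 \<i> + g 1 1 * h \<i> \<i>) /
      (2 * (g 1 1 * g \<i> \<i> - (g 1 \<i>)\<^sup>2)))"

definition minimal :: "(complex \<Rightarrow> ambient) \<Rightarrow> bool"
  where "minimal X \<longleftrightarrow> (\<forall>z N. unit_normal X z N \<longrightarrow> mean_curvature X z N = 0)"

definition conformal_minimal_immersion :: "(complex \<Rightarrow> ambient) \<Rightarrow> bool"
  where "conformal_minimal_immersion X \<longleftrightarrow> immersion_S2xR X \<and> conformal X \<and> minimal X"

text \<open>The quadratic form \<open>\<rho> dz \<otimes> dz-bar\<close>, read as the real symmetric tensor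
  \<open>\<rho> (dx\<^sup>2 + dy\<^sup>2)\<close>.\<close>

definition has_metric :: "(complex \<Rightarrow> ambient) \<Rightarrow> (complex \<Rightarrow> real) \<Rightarrow> bool"
  where "has_metric X \<rho> \<longleftrightarrow> (\<forall>z u v. first_form X z u v = \<rho> z * Re (u * cnj v))"

definition matrix_deriv_z :: "(complex \<Rightarrow> mat2) \<Rightarrow> complex \<Rightarrow> mat2"
  where "matrix_deriv_z G z = (\<chi> i j. deriv_z (\<lambda>w. G w $ i $ j) z)"

text \<open>The coefficient of \<open>dz\<^sup>2\<close> in the Hopf differential of \<open>X = (G, h)\<close>.\<close>

definition Hopf_coeff :: "(complex \<Rightarrow> ambient) \<Rightarrow> complex \<Rightarrow> complex"
  where "Hopf_coeff X z =
    (let Gz = matrix_deriv_z (\<lambda>w. fst (X w)) z in su2_form Gz Gz)"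

section \<open>Extended frames\<close>

definition alpha_dz :: "(complex \<Rightarrow> real) \<Rightarrow> complex \<Rightarrow> complex \<Rightarrow> complex \<Rightarrow> complex \<Rightarrow> mat2"
  where "alpha_dz \<omega> \<delta> \<gamma> lam z =
    (let \<omega>z = deriv_z (\<lambda>w. of_real (\<omega> w)) z in
     cscale (1/4) (mk_mat2
       (2 * \<omega>z) (\<i> * inverse lam * \<delta> * of_real (exp (\<omega> z)))
       (\<i> * \<gamma> * of_real (exp (- \<omega> z))) (- 2 * \<omega>z)))"

definition alpha_dzbar :: "(complex \<Rightarrow> real) \<Rightarrow> complex \<Rightarrow> complex \<Rightarrow> complex \<Rightarrow> complex \<Rightarrow> mat2"
  where "alpha_dzbar \<omega> \<delta> \<gamma> lam z =
    (let \<omega>zbar = deriv_zbar (\<lambda>w. of_real (\<omega> w)) z in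
     cscale (1/4) (mk_mat2
       (- 2 * \<omega>zbar) (\<i> * cnj \<gamma> * of_real (exp (- \<omega> z)))
       (\<i> * lam * cnj \<delta> * of_real (exp (\<omega> z))) (2 * \<omega>zbar)))"

text \<open>The one-form at the point \<open>z\<close> applied to the tangent vector \<open>v\<close>, where \<open>dz\<close> takes the
  value \<open>v\<close> and \<open>dz-bar\<close> the value \<open>cnj v\<close>.\<close>

definition alpha ::
    "(complex \<Rightarrow> real) \<Rightarrow> complex \<Rightarrow> complex \<Rightarrow> complex \<Rightarrow> complex \<Rightarrow> complex \<Rightarrow> mat2"
  where "alpha \<omega> \<delta> \<gamma> lam z v =
    cscale v (alpha_dz \<omega> \<delta> \<gamma> lam z) + cscale (cnj v) (alpha_dzbar \<omega> \<delta> \<gamma> lam z)"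

definition frame_solution ::
    "(complex \<Rightarrow> real) \<Rightarrow> complex \<Rightarrow> complex \<Rightarrow> complex \<Rightarrow> (complex \<Rightarrow> mat2) \<Rightarrow> bool"
  where "frame_solution \<omega> \<delta> \<gamma> lam F \<longleftrightarrow>
    (\<forall>z. invertible (F z) \<and> F differentiable (at z) \<and>
      (\<forall>v. matrix_inv (F z) ** dir_deriv v F z = alpha \<omega> \<delta> \<gamma> lam z v)) \<and>
    F 0 = mat 1"

definition associated_surface :: "(complex \<Rightarrow> mat2) \<Rightarrow> complex \<Rightarrow> complex \<Rightarrow> ambient"
  where "associated_surface F s z =
    (F z ** sigma3 ** matrix_inv (F z), Re (- \<i> * s * z))"

end

theory Submission
  imports Defs
begin

text \<open>The sinh-Gordon equation is the Maurer-Cartan equation of \<open>\<alpha>\<close>, and \<open>\<alpha>\<close> takes values in \<open>su2\<close>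
  because \<open>|\<lambda>| = 1\<close>. A flat \<open>su2\<close>-valued form integrates to a unitary frame: solve the linear
  equation along each ray from the origin; flatness makes the difference of the solutions along two rays,
  minus the expected first variation, solve the same equation with a small source, and unitarity
  bounds it.
  Then \<open>G = F \<sigma>\<^sub>3 F\<^sup>-\<^sup>1\<close> has \<open>dG = F [\<alpha>, \<sigma>\<^sub>3] F\<^sup>-\<^sup>1\<close>, so the metric and the Hopf differential are
  read off from the off-diagonal entries of \<open>\<alpha>\<close>, and the Laplacian of \<open>G\<close> is a multiple of \<open>G\<close>. Since the
  height is linear, the Laplacian of the immersion is orthogonal to the product, which is minimality.\<close>

section \<open>Smooth functions\<close>

lemma dir_deriv_eq: "(f has_derivative f') (at x) \<Longrightarrow> dir_deriv v f x = f' v"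
  unfolding dir_deriv_def using frechet_derivative_at by metis

lemma has_derivative_dir_deriv:
  "f differentiable (at x) \<Longrightarrow> (f has_derivative (\<lambda>v. dir_deriv v f x)) (at x)"
  unfolding dir_deriv_def by (simp add: frechet_derivative_works)

lemma dir_deriv_bounded_linear:
  assumes "bounded_linear L" "f differentiable (at x)"
  shows "dir_deriv v (\<lambda>x. L (f x)) x = L (dir_deriv v f x)"
  by (rule dir_deriv_eq[OF bounded_linear.has_derivative[OF assms(1) has_derivative_dir_deriv[OF assms(2)]]])

text \<open>Lets smoothness be read off an explicit derivative formula. Most closure lemmas below
  are inductions on the order through this rule.\<close>

lemma k_smooth_SucI:
  assumes "\<And>x. (f has_derivative f' x) (at x)" "\<And>v. k_smooth k (\<lambda>x. f' x v)"
  shows "k_smooth (Suc k) f"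
proof -
  have "dir_deriv v f = (\<lambda>x. f' x v)" for v
    using assms(1) dir_deriv_eq by blast
  then show ?thesis
    using assms by (auto simp: differentiable_def)
qed

lemma k_smooth_Suc_has_derivative:
  "k_smooth (Suc k) f \<Longrightarrow> (f has_derivative (\<lambda>v. dir_deriv v f x)) (at x)"
  by (simp add: has_derivative_dir_deriv)

lemma k_smooth_dir_deriv: "k_smooth (Suc k) f \<Longrightarrow> k_smooth k (dir_deriv v f)"
  by simp

lemma k_smooth_const: "k_smooth k (\<lambda>x. c)"
proof (induction k arbitrary: c)
  case (Suc k)
  show ?case
    by (rule k_smooth_SucI[OF has_derivative_const]) (rule Suc.IH)
qed simp

lemma k_smooth_ident: "k_smooth k (\<lambda>x. x)"
proof (cases k)
  case (Suc n)
  show ?thesis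
    unfolding Suc by (rule k_smooth_SucI[OF has_derivative_ident k_smooth_const])
qed simp

lemma k_smooth_SucD: "k_smooth (Suc k) f \<Longrightarrow> k_smooth k f"
proof (induction k arbitrary: f)
  case 0
  then show ?case
    by (simp add: differentiable_imp_continuous_on differentiable_on_def differentiable_at_withinI)
qed auto

lemma k_smooth_add:
  "k_smooth k f \<Longrightarrow> k_smooth k g \<Longrightarrow> k_smooth k (\<lambda>x. f x + g x)"
proof (induction k arbitrary: f g)
  case (Suc k)
  show ?case
    by (rule k_smooth_SucI[OF has_derivative_add[OF Suc.prems[THEN k_smooth_Suc_has_derivative]]])
      (intro Suc.IH k_smooth_dir_deriv Suc.prems)
qed (simp add: continuous_on_add)

lemma k_smooth_bounded_linear:
  assumes "bounded_linear L"
  shows "k_smooth k f \<Longrightarrow> k_smooth k (\<lambda>x. L (f x))"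
proof (induction k arbitrary: f)
  case 0
  then show ?case
    using assms by (simp add: bounded_linear.continuous_on)
next
  case (Suc k)
  show ?case
    by (rule k_smooth_SucI[OF bounded_linear.has_derivative[OF assms k_smooth_Suc_has_derivative[OF Suc.prems]]])
      (intro Suc.IH k_smooth_dir_deriv Suc.prems)
qed

text \<open>Each summand of the product rule keeps one factor undifferentiated;
  \<open>k_smooth_SucD\<close> lowers its order so that the induction hypothesis applies.\<close>

lemma k_smooth_bounded_bilinear:
  assumes "bounded_bilinear b"
  shows "k_smooth k f \<Longrightarrow> k_smooth k g \<Longrightarrow> k_smooth k (\<lambda>x. b (f x) (g x))"
proof (induction k arbitrary: f g)
  case 0
  then show ?case
    using assms by (simp add: bounded_bilinear.continuous_on)
next
  case (Suc k)
  show ?case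
    by (rule k_smooth_SucI[OF bounded_bilinear.FDERIV[OF assms Suc.prems[THEN k_smooth_Suc_has_derivative]]])
      (rule k_smooth_add[OF Suc.IH[OF k_smooth_SucD[OF Suc.prems(1)] k_smooth_dir_deriv[OF Suc.prems(2)]]
          Suc.IH[OF k_smooth_dir_deriv[OF Suc.prems(1)] k_smooth_SucD[OF Suc.prems(2)]]])
qed

lemma k_smooth_exp:
  fixes f :: "'a::real_normed_vector \<Rightarrow> real"
  shows "k_smooth k f \<Longrightarrow> k_smooth k (\<lambda>x. exp (f x))"
proof (induction k arbitrary: f)
  case (Suc k)
  show ?case
    by (rule k_smooth_SucI[OF has_derivative_exp[OF k_smooth_Suc_has_derivative[OF Suc.prems]]])
      (rule k_smooth_bounded_bilinear[OF bounded_bilinear_mult Suc.IH[OF k_smooth_SucD[OF Suc.prems]]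
          k_smooth_dir_deriv[OF Suc.prems]]
        k_smooth_bounded_bilinear[OF bounded_bilinear_mult k_smooth_dir_deriv[OF Suc.prems]
          Suc.IH[OF k_smooth_SucD[OF Suc.prems]]])
qed (simp add: continuous_on_exp)

lemma k_smooth_Pair:
  assumes "k_smooth k f" "k_smooth k g"
  shows "k_smooth k (\<lambda>x. (f x, g x))"
proof -
  have "bounded_linear (\<lambda>a. (a, 0))" "bounded_linear (\<lambda>b. (0, b))"
    by (intro bounded_linear_Pair bounded_linear_ident bounded_linear_zero)+
  from k_smooth_add[OF k_smooth_bounded_linear[OF this(1) assms(1)] k_smooth_bounded_linear[OF this(2) assms(2)]]
  show ?thesis by simp
qed

section \<open>Linear differential equations on the unit interval\<close>

context
  fixes b :: "'a::banach \<Rightarrow> 'b::real_normed_vector \<Rightarrow> 'a" and A :: "real \<Rightarrow> 'b" and y0 :: 'a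
  assumes bb: "bounded_bilinear b" and cA: "continuous_on {0..1} A"
begin

text \<open>The iterated integrals of the Picard scheme for \<open>y' = b y A\<close>,
  \<open>y 0 = y0\<close>. They are the increments of the Picard iterates, so convergence of the
  scheme becomes summability.\<close>

primrec picard_term :: "nat \<Rightarrow> real \<Rightarrow> 'a" where
  "picard_term 0 t = y0"
| "picard_term (Suc n) t = integral {0..t} (\<lambda>s. b (picard_term n s) (A s))"

lemma picard_term_continuous: "continuous_on {0..1} (picard_term n)"
  and picard_term_deriv: "t \<in> {0..1} \<Longrightarrow>
    (picard_term (Suc n) has_vector_derivative b (picard_term n t) (A t)) (at t within {0..1})"
proof -
  \<comment> \<open>The two claims feed each other: continuity of term n gives the derivative of
    term n + 1, which in turn gives its continuity. Hence continuity is a premise here.\<close>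
  have d: "(picard_term (Suc n) has_vector_derivative b (picard_term n t) (A t)) (at t within {0..1})"
    if "t \<in> {0..1}" "continuous_on {0..1} (picard_term n)" for n t
    using integral_has_vector_derivative[OF bounded_bilinear.continuous_on[OF bb that(2) cA] that(1)]
    by (simp add: picard_term.simps(2)[abs_def])
  show c: "continuous_on {0..1} (picard_term n)" for n
  proof (induction n)
    case (Suc n)
    from has_vector_derivative_continuous[OF d[OF _ Suc.IH]] show ?case
      by (simp add: continuous_on_eq_continuous_within del: picard_term.simps)
  qed simp
  show "t \<in> {0..1} \<Longrightarrow>
    (picard_term (Suc n) has_vector_derivative b (picard_term n t) (A t)) (at t within {0..1})"
    by (rule d[OF _ c])
qed

text \<open>The majorant of order n + 1 has C times the majorant of order n as its derivative, so
  the mean value inequality carries the induction and produces the factorial.\<close>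

lemma picard_term_bound:
  assumes C: "C \<ge> 0" "\<And>y t. t \<in> {0..1} \<Longrightarrow> norm (b y (A t)) \<le> C * norm y"
    and "t \<in> {0..1}"
  shows "norm (picard_term n t) \<le> norm y0 * (C * t) ^ n / fact n"
  using assms(3)
proof (induction n arbitrary: t)
  case (Suc n)
  let ?\<phi> = "\<lambda>t. norm y0 * (C * t) ^ Suc n / fact (Suc n)"
  show ?case
  proof (cases "t = 0")
    case False
    then have t: "0 < t" "t \<le> 1" using Suc.prems by auto
    have "norm (picard_term (Suc n) t - picard_term (Suc n) 0) \<le> ?\<phi> t - ?\<phi> 0"
    proof (rule differentiable_bound_general[OF t(1)])
      show "continuous_on {0..t} (picard_term (Suc n))"
        by (rule continuous_on_subset[OF picard_term_continuous]) (use t in auto)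
      show "continuous_on {0..t} ?\<phi>"
        by (intro continuous_intros) auto
      fix x assume x: "0 < x" "x < t"
      have "at x within {0..1} = at x"
        using x t by (intro at_within_interior) auto
      then show "(picard_term (Suc n) has_vector_derivative b (picard_term n x) (A x)) (at x)"
        using picard_term_deriv[of x n] x t by simp
      have "(?\<phi> has_real_derivative norm y0 * (real (Suc n) * (C * x) ^ n * C) / fact (Suc n)) (at x)"
        using DERIV_cdivide[OF DERIV_cmult[OF DERIV_power_Suc[OF DERIV_cmult_Id[of C]]], of "norm y0" n "fact (Suc n)" x]
        by (simp add: mult_ac del: fact_Suc power_Suc)
      moreover have "norm y0 * (real (Suc n) * (C * x) ^ n * C) / fact (Suc n) = C * (norm y0 * (C * x) ^ n / fact n)"
        by (simp only: fact_Suc) (simp add: divide_simps mult_ac del: of_nat_Suc)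
      ultimately show "(?\<phi> has_vector_derivative C * (norm y0 * (C * x) ^ n / fact n)) (at x)"
        by (simp only: has_real_derivative_iff_has_vector_derivative)
      show "norm (b (picard_term n x) (A x)) \<le> C * (norm y0 * (C * x) ^ n / fact n)"
        using C(2)[of x "picard_term n x"] mult_left_mono[OF Suc.IH[of x] C(1)] x t by fastforce
    qed
    then show ?thesis by simp
  qed simp
qed simp

lemma linear_ode_exists:
  "\<exists>y. y 0 = y0 \<and> (\<forall>t\<in>{0..1}. (y has_vector_derivative b (y t) (A t)) (at t within {0..1}))"
proof -
  obtain K where K: "\<And>y a. norm (b y a) \<le> norm y * norm a * K" "K > 0"
    using bounded_bilinear.pos_bounded[OF bb] by blast
  have "compact (A ` {0..1})"
    by (rule compact_continuous_image[OF cA]) simp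
  then obtain M where M: "M > 0" "\<And>t. t \<in> {0..1} \<Longrightarrow> norm (A t) \<le> M"
    using compact_imp_bounded bounded_pos by (metis imageI)
  define C where "C = M * K"
  have C0: "C \<ge> 0" using K M by (simp add: C_def)
  have C: "norm (b y (A t)) \<le> C * norm y" if "t \<in> {0..1}" for y t
  proof -
    have "norm (b y (A t)) \<le> norm y * norm (A t) * K" by (rule K)
    also have "\<dots> \<le> norm y * M * K"
      using M(2)[OF that] K(2) by (intro mult_right_mono mult_left_mono) auto
    finally show ?thesis by (simp add: C_def mult_ac)
  qed
  define y where "y t = (\<Sum>n. picard_term n t)" for t
  have bd: "norm (picard_term n t) \<le> norm y0 * (inverse (fact n) * C ^ n)" if "t \<in> {0..1}" for n t
  proof -
    have "norm (picard_term n t) \<le> norm y0 * (C * t) ^ n / fact n"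
      using picard_term_bound[OF C0 C that] by simp
    also have "\<dots> \<le> norm y0 * C ^ n / fact n"
      using that C0 by (intro divide_right_mono mult_left_mono power_mono) (auto simp: mult_left_le)
    finally show ?thesis by (simp add: field_simps)
  qed
  have sm: "summable (\<lambda>n. norm y0 * (inverse (fact n) * C ^ n))"
    by (intro summable_mult summable_exp)
  have ul: "uniform_limit {0..1} (\<lambda>n t. \<Sum>i<n. picard_term i t) y sequentially"
    unfolding y_def by (rule Weierstrass_m_test[OF bd sm])
  have sums: "(\<lambda>n. picard_term n t) sums y t" if "t \<in> {0..1}" for t
    using tendsto_uniform_limitI[OF ul that] by (simp add: sums_def)
  \<comment> \<open>The series is shifted by one: the derivatives of the terms n + 1 sum to
    \<open>b (y t) (A t)\<close>. The missing term \<open>y0\<close> is added back in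
    \<open>yg\<close>.\<close>
  have "\<exists>g. \<forall>t\<in>{0..1}. (\<lambda>n. picard_term (Suc n) t) sums g t \<and>
      (g has_derivative (\<lambda>h. h *\<^sub>R b (y t) (A t))) (at t within {0..1})"
  proof (rule has_derivative_series)
    show "(picard_term (Suc n) has_derivative (\<lambda>h. h *\<^sub>R b (picard_term n t) (A t))) (at t within {0..1})"
      if "t \<in> {0..1}" for n t
      using picard_term_deriv[OF that] by (simp only: has_vector_derivative_def)
    show "(\<lambda>n. picard_term (Suc n) 0) sums 0" by simp
    fix e :: real assume "e > 0"
    \<comment> \<open>C may be zero, hence the denominator C + 1.\<close>
    then have "e / (C + 1) > 0" using C0 by simp
    from uniform_limitD[OF ul this]
    show "\<forall>\<^sub>F n in sequentially. \<forall>t\<in>{0..1}. \<forall>h.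
      norm ((\<Sum>i<n. h *\<^sub>R b (picard_term i t) (A t)) - h *\<^sub>R b (y t) (A t)) \<le> e * norm h"
    proof (rule eventually_mono, safe)
      fix n and t h :: real
      assume *: "\<forall>t\<in>{0..1}. dist (\<Sum>i<n. picard_term i t) (y t) < e / (C + 1)" and t: "t \<in> {0..1}"
      have "norm ((\<Sum>i<n. h *\<^sub>R b (picard_term i t) (A t)) - h *\<^sub>R b (y t) (A t))
          = \<bar>h\<bar> * norm (b ((\<Sum>i<n. picard_term i t) - y t) (A t))"
        by (simp add: bounded_bilinear.sum_left[OF bb] bounded_bilinear.diff_left[OF bb]
            flip: scaleR_sum_right scaleR_diff_right)
      also have "\<dots> \<le> \<bar>h\<bar> * (C * norm ((\<Sum>i<n. picard_term i t) - y t))"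
        by (intro mult_left_mono C t) simp
      also have "\<dots> \<le> \<bar>h\<bar> * (C * (e / (C + 1)))"
        using * t C0 by (intro mult_left_mono) (auto simp: dist_norm less_imp_le)
      also have "\<dots> \<le> \<bar>h\<bar> * e"
        using C0 \<open>e > 0\<close> by (intro mult_left_mono) (auto simp: field_simps)
      finally show "norm ((\<Sum>i<n. h *\<^sub>R b (picard_term i t) (A t)) - h *\<^sub>R b (y t) (A t)) \<le> e * norm h"
        by (simp add: mult.commute)
    qed
  qed auto
  then obtain g where g: "\<And>t. t \<in> {0..1} \<Longrightarrow> (\<lambda>n. picard_term (Suc n) t) sums g t"
      "\<And>t. t \<in> {0..1} \<Longrightarrow> (g has_vector_derivative b (y t) (A t)) (at t within {0..1})"
    unfolding has_vector_derivative_def by blast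
  have yg: "y t = g t + y0" if "t \<in> {0..1}" for t
    using sums_unique2[OF sums[OF that] sums_Suc[OF g(1)[OF that]]] by simp
  have "(y has_vector_derivative b (y t) (A t)) (at t within {0..1})" if "t \<in> {0..1}" for t
    by (rule has_vector_derivative_transform[OF that yg])
      (auto intro!: derivative_eq_intros g that)
  moreover have "y 0 = y0"
    using sums_unique2[OF g(1)[of 0], of 0] yg[of 0] by simp
  ultimately show ?thesis by blast
qed

end

section \<open>Unitary solutions\<close>

lemma bounded_bilinear_matrix_mult:
  "bounded_bilinear ((**) :: complex^'n^'m \<Rightarrow> complex^'p^'n \<Rightarrow> complex^'p^'m)"
  by (rule bilinear_conv_bounded_bilinear[THEN iffD1])
    (auto simp: bilinear_def matrix_matrix_mult_def vec_eq_iff sum.distrib ring_distribs scaleR_sum_right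
      intro!: linearI)

lemmas matrix_mult_simps =
  bounded_bilinear.add_left[OF bounded_bilinear_matrix_mult]
  bounded_bilinear.add_right[OF bounded_bilinear_matrix_mult]
  bounded_bilinear.diff_left[OF bounded_bilinear_matrix_mult]
  bounded_bilinear.diff_right[OF bounded_bilinear_matrix_mult]
  bounded_bilinear.minus_left[OF bounded_bilinear_matrix_mult]
  bounded_bilinear.minus_right[OF bounded_bilinear_matrix_mult]
  bounded_bilinear.zero_left[OF bounded_bilinear_matrix_mult]
  bounded_bilinear.zero_right[OF bounded_bilinear_matrix_mult]
  bounded_bilinear.scaleR_left[OF bounded_bilinear_matrix_mult]
  bounded_bilinear.scaleR_right[OF bounded_bilinear_matrix_mult]

definition cadj :: "complex^'n^'m \<Rightarrow> complex^'m^'n"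
  where "cadj A = map_matrix cnj (transpose A)"

lemma cadj_nth: "cadj A $ i $ j = cnj (A $ j $ i)"
  by (simp add: cadj_def transpose_def map_matrix_def)

lemma bounded_linear_cadj: "bounded_linear (cadj :: complex^'n^'m \<Rightarrow> _)"
  by (rule linear_conv_bounded_linear[THEN iffD1])
    (auto intro!: linearI simp: vec_eq_iff cadj_nth)

lemma cadj_mult: "cadj (A ** B) = cadj B ** cadj A"
  by (simp add: vec_eq_iff cadj_nth matrix_matrix_mult_def mult.commute)

lemma cadj_cadj [simp]: "cadj (cadj A) = A"
  by (simp add: vec_eq_iff cadj_nth)

lemma cadj_mat_1 [simp]: "cadj (mat 1) = (mat 1 :: complex^'n^'n)"
  by (auto simp: vec_eq_iff cadj_nth mat_def)

text \<open>Every row is a unit vector. This uniform bound on unitary solutions takes the place of a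
  Gronwall estimate in the integration theorem.\<close>

lemma norm_unitary:
  fixes A :: "complex^'n^'n"
  assumes "A ** cadj A = mat 1"
  shows "norm A = sqrt (real CARD('n))"
proof -
  have "(norm (A $ i))\<^sup>2 = 1" for i
  proof -
    have "of_real ((norm (A $ i))\<^sup>2) = (\<Sum>j\<in>UNIV. A $ i $ j * cnj (A $ i $ j))"
      by (simp add: norm_vec_def L2_set_def sum_nonneg flip: complex_norm_square)
    also have "\<dots> = (A ** cadj A) $ i $ i"
      by (simp add: matrix_matrix_mult_def cadj_nth)
    also have "\<dots> = 1"
      by (simp add: assms mat_def)
    finally show ?thesis
      using of_real_eq_1_iff by blast
  qed
  then show ?thesis
    by (simp add: norm_vec_def[of A] L2_set_def)
qed

text \<open>The adjoint of a solution of \<open>dg = g b\<close> is an integrating factor for perturbed equations with the same \<open>b\<close>.\<close>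

lemma skew_product_derivative:
  assumes "(f has_derivative (\<lambda>v. f x ** b v + E v)) (at x within S)"
    and "(g has_derivative (\<lambda>v. g x ** b v)) (at x within S)"
    and "\<And>v. cadj (b v) = - b v"
  shows "((\<lambda>x. f x ** cadj (g x)) has_derivative (\<lambda>v. E v ** cadj (g x))) (at x within S)"
  by (rule has_derivative_eq_rhs[OF bounded_bilinear.FDERIV[OF bounded_bilinear_matrix_mult assms(1)
          bounded_linear.has_derivative[OF bounded_linear_cadj assms(2)]]])
    (simp add: cadj_mult assms(3) matrix_mult_simps matrix_mul_assoc)

text \<open>The two contributions of \<open>b\<close> cancel by skewness, so the product is
  constant. For G = F this is unitarity; for two solutions it yields uniqueness.\<close>

lemma unitary_product:
  fixes F G :: "'e::real_normed_vector \<Rightarrow> complex^'n^'n"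
  assumes F: "\<And>z. (F has_derivative (\<lambda>v. F z ** b z v)) (at z)"
    and G: "\<And>z. (G has_derivative (\<lambda>v. G z ** b z v)) (at z)"
    and skew: "\<And>z v. cadj (b z v) = - b z v"
    and "F 0 = mat 1" and "G 0 = mat 1"
  shows "F z ** cadj (G z) = mat 1"
proof -
  have "((\<lambda>z. F z ** cadj (G z)) has_derivative (\<lambda>h. 0)) (at z)" for z
    by (rule has_derivative_eq_rhs[OF skew_product_derivative[where E="\<lambda>h. 0" and b="b z"]])
      (use F G skew in \<open>simp_all add: matrix_mult_simps\<close>)
  then obtain c where c: "\<And>z. F z ** cadj (G z) = c"
    using has_derivative_zero_constant[of UNIV "\<lambda>z. F z ** cadj (G z)"] by auto
  from c[of z] c[of 0] show ?thesis by (simp add: assms)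
qed

section \<open>Estimates uniform along a segment\<close>

lemma uniform_near_segment:
  fixes f :: "'e::euclidean_space \<Rightarrow> 'b::metric_space"
  assumes "continuous_on UNIV f" and "e > 0"
  shows "\<exists>d>0. \<forall>t\<in>{0..1}. \<forall>x. dist x (t *\<^sub>R z) < d \<longrightarrow> dist (f x) (f (t *\<^sub>R z)) < e"
proof -
  have "uniformly_continuous_on (cball 0 (norm z + 1)) f"
    by (intro compact_uniformly_continuous continuous_on_subset[OF assms(1)]) auto
  then obtain d where d: "d > 0"
    "\<And>x y. x \<in> cball 0 (norm z + 1) \<Longrightarrow> y \<in> cball 0 (norm z + 1) \<Longrightarrow> dist y x < d \<Longrightarrow> dist (f y) (f x) < e"
    unfolding uniformly_continuous_on_def using assms(2) by metis
  show ?thesis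
  \<comment> \<open>The bound 1 keeps x inside the compact ball of radius \<open>norm z + 1\<close>,
    where f is uniformly continuous.\<close>
  proof (intro exI[of _ "min d 1"] conjI ballI allI impI)
    fix t :: real and x assume t: "t \<in> {0..1}" and x: "dist x (t *\<^sub>R z) < min d 1"
    have *: "norm (t *\<^sub>R z) \<le> norm z"
      using t by (simp add: mult_left_le_one_le)
    moreover have "norm x \<le> norm (t *\<^sub>R z) + dist x (t *\<^sub>R z)"
      by (metis dist_commute dist_norm norm_triangle_sub)
    ultimately show "dist (f x) (f (t *\<^sub>R z)) < e"
      using x by (intro d(2)) auto
  qed (use d in auto)
qed

text \<open>In finite dimension, continuity of each directional derivative is continuity of the
  derivative in operator norm. Its oscillation near the segment is then small uniformly in t, and
  the mean value inequality bounds the linearization error.\<close>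

lemma uniform_linearization_near_segment:
  fixes f :: "'e::euclidean_space \<Rightarrow> 'b::real_normed_vector"
  assumes der: "\<And>x. (f has_derivative f' x) (at x)"
    and cont: "\<And>u. continuous_on UNIV (\<lambda>x. f' x u)" and "e > 0"
  shows "\<exists>d>0. \<forall>t\<in>{0..1}. \<forall>v. norm v < d \<longrightarrow>
    norm (f (t *\<^sub>R (z + v)) - f (t *\<^sub>R z) - f' (t *\<^sub>R z) (t *\<^sub>R v)) \<le> e * norm v"
proof -
  define L where "L x = Blinfun (f' x)" for x
  have L: "blinfun_apply (L x) = f' x" for x
    unfolding L_def using der has_derivative_bounded_linear by (intro bounded_linear_Blinfun_apply) blast
  have "continuous_on UNIV L"
    by (intro continuous_on_blinfun_componentwise) (simp add: L cont)
  from uniform_near_segment[OF this \<open>e > 0\<close>, of z] obtain d where d: "d > 0"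
    "\<And>t x. t \<in> {0..1} \<Longrightarrow> dist x (t *\<^sub>R z) < d \<Longrightarrow> dist (L x) (L (t *\<^sub>R z)) < e"
    by blast
  show ?thesis
  proof (intro exI[of _ d] conjI ballI allI impI)
    fix t :: real and v :: 'e assume t: "t \<in> {0..1}" and v: "norm v < d"
    have tv: "norm (t *\<^sub>R v) \<le> norm v"
      using t by (simp add: mult_left_le_one_le)
    have "norm (f (t *\<^sub>R (z + v)) - f (t *\<^sub>R z) - f' (t *\<^sub>R z) (t *\<^sub>R (z + v) - t *\<^sub>R z))
        \<le> norm (t *\<^sub>R (z + v) - t *\<^sub>R z) * e"
    proof (rule differentiable_bound_linearization[where S="ball (t *\<^sub>R z) d" and f'=f'])
      fix s :: real assume "s \<in> {0..1}"
      then have "norm (s *\<^sub>R (t *\<^sub>R v)) \<le> norm (t *\<^sub>R v)"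
        by (simp only: norm_scaleR) (simp add: mult_left_le_one_le)
      then show "t *\<^sub>R z + s *\<^sub>R (t *\<^sub>R (z + v) - t *\<^sub>R z) \<in> ball (t *\<^sub>R z) d"
        using tv v by (simp add: dist_norm algebra_simps)
    next
      fix x assume "x \<in> ball (t *\<^sub>R z) d"
      then have "norm (L x - L (t *\<^sub>R z)) < e"
        using d(2)[OF t, of x] by (simp add: dist_norm dist_commute norm_minus_commute)
      then show "onorm (f' x - f' (t *\<^sub>R z)) \<le> e"
        by (simp add: norm_blinfun.rep_eq blinfun.diff_left[abs_def] L fun_diff_def)
    qed (use d der in \<open>auto intro: has_derivative_at_withinI\<close>)
    also have "\<dots> = norm (t *\<^sub>R v) * e"
      by (simp add: algebra_simps)
    also have "\<dots> \<le> e * norm v"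
      using mult_right_mono[OF tv, of e] \<open>e > 0\<close> by (simp add: mult.commute)
    finally show "norm (f (t *\<^sub>R (z + v)) - f (t *\<^sub>R z) - f' (t *\<^sub>R z) (t *\<^sub>R v)) \<le> e * norm v"
      by (simp add: algebra_simps)
  qed (fact d)
qed

lemma unit_interval_derivative_bound:
  fixes f :: "real \<Rightarrow> 'a::real_normed_vector"
  assumes "\<And>t. t \<in> {0..1} \<Longrightarrow> (f has_vector_derivative f' t) (at t within {0..1})"
    and "\<And>t. t \<in> {0..1} \<Longrightarrow> norm (f' t) \<le> B"
  shows "norm (f 1 - f 0) \<le> B"
proof -
  have "norm (f 1 - f 0) \<le> B * norm (1 - 0 :: real)"
  proof (rule differentiable_bound[OF _ assms(1)[unfolded has_vector_derivative_def]])
    show "onorm (\<lambda>h. h *\<^sub>R f' t) \<le> B" if "t \<in> {0..1}" for t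
      by (rule onorm_le) (use assms(2)[OF that] in \<open>simp add: mult.commute[of B] mult_left_mono\<close>)
  qed auto
  then show ?thesis by simp
qed

section \<open>Integration of flat forms\<close>

text \<open>The witness at z is the time-one value of the solution along the ray from 0 to z. Here
  \<open>d\<beta> z u v\<close> differentiates in direction u, so \<open>flat\<close> is the
  Maurer-Cartan equation evaluated on u and v.\<close>

theorem flat_skew_form_integrable:
  fixes \<beta> :: "'e::euclidean_space \<Rightarrow> 'e \<Rightarrow> complex^'n^'n" and d\<beta> :: "'e \<Rightarrow> 'e \<Rightarrow> 'e \<Rightarrow> complex^'n^'n"
  assumes lin: "\<And>z. linear (\<beta> z)"
    and der: "\<And>z v. ((\<lambda>z. \<beta> z v) has_derivative (\<lambda>u. d\<beta> z u v)) (at z)"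
    and cont: "\<And>u v. continuous_on UNIV (\<lambda>z. d\<beta> z u v)"
    and skew: "\<And>z v. cadj (\<beta> z v) = - \<beta> z v"
    and flat: "\<And>z u v. d\<beta> z u v - d\<beta> z v u = \<beta> z v ** \<beta> z u - \<beta> z u ** \<beta> z v"
  shows "\<exists>F. F 0 = mat 1 \<and> (\<forall>z. (F has_derivative (\<lambda>v. F z ** \<beta> z v)) (at z))"
proof -
  note bm = bounded_bilinear_matrix_mult[where ?'n='n and ?'m='n and ?'p='n]
  have blin: "bounded_linear (\<beta> z)" for z
    using lin by (simp add: linear_conv_bounded_linear)
  have along: "((\<lambda>t. \<beta> (t *\<^sub>R z) v) has_vector_derivative d\<beta> (t *\<^sub>R z) z v) (at t within S)" for t z v S
  proof -
    have "((\<lambda>t. t *\<^sub>R z) has_derivative (\<lambda>h. h *\<^sub>R z)) (at t within S)"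
      by (auto intro!: derivative_eq_intros)
    from has_derivative_compose[OF this der]
    have "((\<lambda>t. \<beta> (t *\<^sub>R z) v) has_derivative (\<lambda>h. d\<beta> (t *\<^sub>R z) (h *\<^sub>R z) v)) (at t within S)" .
    moreover have "d\<beta> (t *\<^sub>R z) (h *\<^sub>R z) v = h *\<^sub>R d\<beta> (t *\<^sub>R z) z v" for h
      using linear_scale[OF has_derivative_linear[OF der]] .
    ultimately show ?thesis by (simp add: has_vector_derivative_def)
  qed
  have "\<exists>y. y 0 = mat 1 \<and> (\<forall>t\<in>{0..1}.
      (y has_vector_derivative y t ** \<beta> (t *\<^sub>R z) z) (at t within {0..1}))" for z
    by (rule linear_ode_exists[OF bm])
      (unfold continuous_on_eq_continuous_within, intro ballI has_vector_derivative_continuous[OF along])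
  then obtain y where y0: "\<And>z. y z 0 = mat 1" and
    yd: "\<And>z t. t \<in> {0..1} \<Longrightarrow> (y z has_vector_derivative y z t ** \<beta> (t *\<^sub>R z) z) (at t within {0..1})"
    by metis
  have un: "y z t ** cadj (y z t) = mat 1" if t: "t \<in> {0..1}" for z t
  proof -
    have "((\<lambda>s. y z s ** cadj (y z s)) has_derivative (\<lambda>h. 0)) (at s within {0..1})" if "s \<in> {0..1}" for s
      by (rule has_derivative_eq_rhs[OF skew_product_derivative[where E="\<lambda>h. 0" and b="\<lambda>h. h *\<^sub>R \<beta> (s *\<^sub>R z) z"]])
        (use yd[OF that, of z] in \<open>auto simp: has_vector_derivative_def matrix_mult_simps
          linear_scale[OF bounded_linear.linear[OF bounded_linear_cadj]] skew\<close>)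
    then obtain c where "\<And>s. s \<in> {0..1} \<Longrightarrow> y z s ** cadj (y z s) = c"
      using has_derivative_zero_constant[of "{0..1}" "\<lambda>s. y z s ** cadj (y z s)"] by auto
    from this[OF t] this[of 0] show ?thesis by (simp add: y0)
  qed
  then have un': "cadj (y z t) ** y z t = mat 1" if "t \<in> {0..1}" for z t
    using that matrix_left_right_inverse by blast
  \<comment> \<open>All ray solutions and their adjoints share this norm, for every endpoint and
    every t.\<close>
  define B where "B = sqrt (real CARD('n))"
  have B0: "B \<ge> 0" by (simp add: B_def)
  have nB: "norm (y z t) = B" if "t \<in> {0..1}" for z t
    using norm_unitary[OF un[OF that]] by (simp add: B_def)
  have nB': "norm (cadj (y z t)) = B" if "t \<in> {0..1}" for z t
    using norm_unitary[of "cadj (y z t)"] un'[OF that] by (simp add: B_def)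
  obtain K where K: "\<And>(a :: complex^'n^'n) (b :: complex^'n^'n). norm (a ** b) \<le> norm a * norm b * K" and K0: "K > 0"
    using bounded_bilinear.pos_bounded[OF bm] by blast
  have mul: "norm (a ** b) \<le> p * q * K" if "norm a \<le> p" "norm b \<le> q" for a b :: "complex^'n^'n" and p q
  proof -
    have "norm a * norm b * K \<le> p * q * K"
      using that K0 by (intro mult_right_mono mult_mono) (auto intro: order_trans[OF norm_ge_zero])
    then show ?thesis using K[of a b] by linarith
  qed
  have "((\<lambda>z. y z 1) has_derivative (\<lambda>v. y z 1 ** \<beta> z v)) (at z)" for z
    unfolding has_derivative_at_alt
  proof (intro conjI allI impI)
    show "bounded_linear (\<lambda>v. y z 1 ** \<beta> z v)"
      by (rule bounded_linear_compose[OF bounded_bilinear.bounded_linear_right[OF bm] blin])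
    define L where "L x = Blinfun (\<beta> x)" for x
    have L: "blinfun_apply (L x) = \<beta> x" for x
      unfolding L_def using blin by (intro bounded_linear_Blinfun_apply)
    have cL: "continuous_on UNIV L"
      by (intro continuous_on_blinfun_componentwise)
        (simp add: L continuous_on_eq_continuous_within has_derivative_continuous[OF der])
    have "compact (L ` (\<lambda>t. t *\<^sub>R z) ` {0..1})"
      by (intro compact_continuous_image continuous_intros continuous_on_subset[OF cL]) auto
    then obtain M where M0: "M > 0" and "\<And>t. t \<in> {0..1} \<Longrightarrow> norm (L (t *\<^sub>R z)) \<le> M"
      using compact_imp_bounded bounded_pos by (metis imageI)
    then have M: "norm (\<beta> (t *\<^sub>R z) v) \<le> M * norm v" if "t \<in> {0..1}" for t v
      using norm_blinfun[of "L (t *\<^sub>R z)" v] that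
      by (simp add: L) (meson mult_right_mono norm_ge_zero order_trans)
    fix e :: real assume e: "e > 0"
    \<comment> \<open>C is the factor in the final bound of the source E. The two further factors
      \<open>B * K\<close> in \<epsilon> pay for multiplying by the adjoint of the solution and then
      back by the solution; the summand 1 keeps the denominator positive.\<close>
    define C where "C = B * M * K * K + 2 * B * K"
    define \<epsilon> where "\<epsilon> = e / (C * B * K * B * K + 1)"
    have C0: "C \<ge> 0" using B0 M0 K0 by (simp add: C_def)
    then have CB: "C * B * K * B * K \<ge> 0" using B0 K0 by simp
    then have \<epsilon>: "\<epsilon> > 0" "C * \<epsilon> * B * K * B * K \<le> e"
      using e by (auto simp: \<epsilon>_def field_simps)
    \<comment> \<open>Half of \<epsilon> is reserved for moving the base point of \<beta> with an
      argument of norm at most \<open>norm z + 1\<close>; the other half goes to the change of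
      argument, through \<open>M * norm v\<close>.\<close>
    define \<eta> where "\<eta> = min \<epsilon> (\<epsilon> / (2 * (norm z + 1)))"
    have \<eta>: "\<eta> > 0" "\<eta> \<le> \<epsilon>" "\<eta> * (norm z + 1) \<le> \<epsilon> / 2"
    proof -
      show "\<eta> > 0" "\<eta> \<le> \<epsilon>"
        using \<epsilon>(1) by (auto simp: \<eta>_def intro!: divide_pos_pos add_nonneg_pos)
      have "\<eta> * (norm z + 1) \<le> \<epsilon> / (2 * (norm z + 1)) * (norm z + 1)"
        by (intro mult_right_mono) (auto simp: \<eta>_def)
      also have "\<dots> = \<epsilon> / 2"
      proof -
        have "norm z + 1 \<noteq> 0"
          using norm_ge_zero[of z] by linarith
        from nonzero_mult_divide_mult_cancel_right[OF this, of \<epsilon> 2] show ?thesis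
          by (simp only: times_divide_eq_left)
      qed
      finally show "\<eta> * (norm z + 1) \<le> \<epsilon> / 2" .
    qed
    obtain d1 where d1: "d1 > 0" "\<And>t x. t \<in> {0..1} \<Longrightarrow> dist x (t *\<^sub>R z) < d1 \<Longrightarrow> dist (L x) (L (t *\<^sub>R z)) < \<eta>"
      using uniform_near_segment[OF cL \<eta>(1), of z] by blast
    obtain d2 where d2: "d2 > 0" "\<And>t v. t \<in> {0..1} \<Longrightarrow> norm v < d2 \<Longrightarrow>
        norm (\<beta> (t *\<^sub>R (z + v)) z - \<beta> (t *\<^sub>R z) z - d\<beta> (t *\<^sub>R z) (t *\<^sub>R v) z) \<le> \<epsilon> * norm v"
      using uniform_linearization_near_segment[OF der cont \<epsilon>(1), of z z] by blast
    show "\<exists>d>0. \<forall>x. norm (x - z) < d \<longrightarrow>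
        norm (y x 1 - y z 1 - y z 1 ** \<beta> z (x - z)) \<le> e * norm (x - z)"
    proof (intro exI[of _ "min (min d1 d2) (min 1 (\<epsilon> / (2 * M)))"] conjI allI impI)
      show "min (min d1 d2) (min 1 (\<epsilon> / (2 * M))) > 0"
        using d1 d2 \<epsilon> M0 by simp
      fix x assume "norm (x - z) < min (min d1 d2) (min 1 (\<epsilon> / (2 * M)))"
      define v where "v = x - z"
      have x: "x = z + v" by (simp add: v_def)
      have v: "norm v < d1" "norm v < d2" "norm v < 1" "norm v * M \<le> \<epsilon> / 2"
        using \<open>norm (x - z) < _\<close> M0 by (auto simp: v_def field_simps)
      text \<open>\<open>D\<close> is the expected first variation of the solution along the ray. By flatness the error \<open>R\<close>
        solves the equation along the ray through \<open>x\<close> up to the source \<open>E\<close>, which is \<open>o(norm v)\<close>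
        uniformly in \<open>t\<close>.\<close>
      define D where "D t = t *\<^sub>R (y z t ** \<beta> (t *\<^sub>R z) v)" for t
      define R where "R t = y x t - y z t - D t" for t
      define E where "E t = D t ** (\<beta> (t *\<^sub>R x) x - \<beta> (t *\<^sub>R z) z) +
        y z t ** (\<beta> (t *\<^sub>R x) x - \<beta> (t *\<^sub>R z) z - \<beta> (t *\<^sub>R z) v - t *\<^sub>R d\<beta> (t *\<^sub>R z) v z)" for t
      have Rd: "(R has_vector_derivative (R t ** \<beta> (t *\<^sub>R x) x + E t)) (at t within {0..1})"
        if t: "t \<in> {0..1}" for t
      proof -
        \<comment> \<open>Differentiating D brings in the derivative of \<open>\<beta> _ v\<close>
          along z. Flatness trades it for the derivative of \<open>\<beta> _ z\<close> along v, the
          first-order change of the coefficient, and the commutator reorders the product so that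
          \<open>D t\<close> stands to the left of \<open>\<beta> (t *\<^sub>R z) z\<close>.\<close>
        have fl: "d\<beta> (t *\<^sub>R z) z v = d\<beta> (t *\<^sub>R z) v z + (\<beta> (t *\<^sub>R z) v ** \<beta> (t *\<^sub>R z) z - \<beta> (t *\<^sub>R z) z ** \<beta> (t *\<^sub>R z) v)"
          using flat[of "t *\<^sub>R z" z v] by (simp add: algebra_simps)
        have "(D has_vector_derivative
            t *\<^sub>R (y z t ** d\<beta> (t *\<^sub>R z) z v + (y z t ** \<beta> (t *\<^sub>R z) z) ** \<beta> (t *\<^sub>R z) v)
            + 1 *\<^sub>R (y z t ** \<beta> (t *\<^sub>R z) v)) (at t within {0..1})"
          unfolding D_def
          by (rule bounded_bilinear.has_vector_derivative[OF bounded_bilinear_scaleR has_vector_derivative_id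
                bounded_bilinear.has_vector_derivative[OF bm yd[OF t] along]])
        then show ?thesis
          unfolding R_def
          by (rule has_vector_derivative_eq_rhs[OF has_vector_derivative_diff[OF has_vector_derivative_diff[OF yd[OF t] yd[OF t]]]])
            (simp add: E_def D_def fl matrix_mult_simps matrix_mul_assoc scaleR_add_right scaleR_diff_right algebra_simps)
      qed
      have "((\<lambda>t. R t ** cadj (y x t)) has_vector_derivative E t ** cadj (y x t)) (at t within {0..1})"
        if t: "t \<in> {0..1}" for t
        unfolding has_vector_derivative_def
        by (rule has_derivative_eq_rhs[OF skew_product_derivative[where E="\<lambda>h. h *\<^sub>R E t" and b="\<lambda>h. h *\<^sub>R \<beta> (t *\<^sub>R x) x"]])
          (use Rd[OF t] yd[OF t, of x] in \<open>auto simp: has_vector_derivative_def matrix_mult_simps scaleR_add_right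
          linear_scale[OF bounded_linear.linear[OF bounded_linear_cadj]] skew\<close>)
      moreover have "norm (E t ** cadj (y x t)) \<le> C * \<epsilon> * norm v * B * K" if t: "t \<in> {0..1}" for t
      proof -
        have "norm (t *\<^sub>R v) \<le> norm v"
          using t by (simp add: mult_left_le_one_le)
        then have "dist (t *\<^sub>R x) (t *\<^sub>R z) < d1"
          using v by (simp add: dist_norm x algebra_simps)
        from d1(2)[OF t this] have Ld: "norm (\<beta> (t *\<^sub>R x) w - \<beta> (t *\<^sub>R z) w) \<le> \<eta> * norm w" for w
          using norm_blinfun[of "L (t *\<^sub>R x) - L (t *\<^sub>R z)" w]
          by (simp add: dist_norm blinfun.diff_left L) (meson mult_right_mono norm_ge_zero order_trans less_imp_le)
        have \<beta>x: "\<beta> (t *\<^sub>R x) x = \<beta> (t *\<^sub>R x) z + \<beta> (t *\<^sub>R x) v" "\<beta> (t *\<^sub>R z) x = \<beta> (t *\<^sub>R z) z + \<beta> (t *\<^sub>R z) v"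
          unfolding x by (rule linear_add[OF lin])+
        have "norm (\<beta> (t *\<^sub>R x) x - \<beta> (t *\<^sub>R z) z)
            = norm ((\<beta> (t *\<^sub>R x) x - \<beta> (t *\<^sub>R z) x) + \<beta> (t *\<^sub>R z) v)"
          by (simp add: \<beta>x(2))
        also have "\<dots> \<le> \<eta> * norm x + M * norm v"
          by (rule order_trans[OF norm_triangle_ineq add_mono[OF Ld M[OF t]]])
        also have "\<eta> * norm x \<le> \<eta> * (norm z + 1)"
          using norm_triangle_ineq[of z v] v \<eta> by (intro mult_left_mono) (auto simp: x)
        finally have n1: "norm (\<beta> (t *\<^sub>R x) x - \<beta> (t *\<^sub>R z) z) \<le> \<epsilon>"
          using \<eta>(3) v(4) by (simp add: mult.commute)
        \<comment> \<open>With x = z + v this splits into the linearization error of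
          \<open>\<beta> _ z\<close> and the oscillation of \<open>\<beta> _ v\<close>, each of
          order \<epsilon> times \<open>norm v\<close>.\<close>
        have "norm (\<beta> (t *\<^sub>R x) x - \<beta> (t *\<^sub>R z) z - \<beta> (t *\<^sub>R z) v - t *\<^sub>R d\<beta> (t *\<^sub>R z) v z)
            = norm ((\<beta> (t *\<^sub>R x) z - \<beta> (t *\<^sub>R z) z - d\<beta> (t *\<^sub>R z) (t *\<^sub>R v) z) + (\<beta> (t *\<^sub>R x) v - \<beta> (t *\<^sub>R z) v))"
          by (simp add: \<beta>x linear_scale[OF has_derivative_linear[OF der]] algebra_simps)
        also have "\<dots> \<le> \<epsilon> * norm v + \<eta> * norm v"
          using d2(2)[OF t v(2)] by (intro order_trans[OF norm_triangle_ineq] add_mono Ld) (simp add: x)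
        also have "\<dots> \<le> 2 * \<epsilon> * norm v"
          using mult_right_mono[OF \<eta>(2) norm_ge_zero[of v]] by simp
        finally have n2: "norm (\<beta> (t *\<^sub>R x) x - \<beta> (t *\<^sub>R z) z - \<beta> (t *\<^sub>R z) v - t *\<^sub>R d\<beta> (t *\<^sub>R z) v z) \<le> 2 * \<epsilon> * norm v" .
        have "norm (D t) \<le> norm (y z t ** \<beta> (t *\<^sub>R z) v)"
          using t by (simp add: D_def mult_left_le_one_le)
        also have "\<dots> \<le> B * (M * norm v) * K"
          using nB[OF t] M[OF t] by (intro mul) auto
        finally have "norm (E t) \<le> B * (M * norm v) * K * \<epsilon> * K + B * (2 * \<epsilon> * norm v) * K"
          unfolding E_def using nB[OF t] by (intro order_trans[OF norm_triangle_ineq] add_mono mul n1 n2) auto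
        also have "\<dots> = C * \<epsilon> * norm v"
          by (simp add: C_def algebra_simps)
        finally show ?thesis
          using nB'[OF t, of x] by (intro mul) auto
      qed
      ultimately have "norm (R 1 ** cadj (y x 1) - R 0 ** cadj (y x 0)) \<le> C * \<epsilon> * norm v * B * K"
        by (rule unit_interval_derivative_bound)
      moreover have "R 0 = 0" by (simp add: R_def D_def y0)
      ultimately have "norm (R 1 ** cadj (y x 1)) \<le> C * \<epsilon> * norm v * B * K"
        by (simp add: matrix_mult_simps)
      \<comment> \<open>Multiplying by the unitary \<open>y x 1\<close> undoes the integrating
        factor and recovers \<open>R 1\<close>.\<close>
      then have "norm ((R 1 ** cadj (y x 1)) ** y x 1) \<le> C * \<epsilon> * norm v * B * K * B * K"
        by (rule mul) (simp add: nB)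
      also have "\<dots> = (C * \<epsilon> * B * K * B * K) * norm v"
        by (simp add: mult_ac)
      also have "\<dots> \<le> e * norm v"
        using \<epsilon>(2) by (rule mult_right_mono) simp
      also have "(R 1 ** cadj (y x 1)) ** y x 1 = R 1"
        using un'[of 1 x] by (simp flip: matrix_mul_assoc)
      finally show "norm (y x 1 - y z 1 - y z 1 ** \<beta> z (x - z)) \<le> e * norm (x - z)"
        by (simp add: R_def D_def v_def)
    qed
  qed
  \<comment> \<open>The ray to the origin is constant, so its equation has zero right-hand
    side.\<close>
  moreover have "y 0 1 = mat 1"
  proof -
    have "norm (y 0 1 - y 0 0) \<le> 0"
      by (rule unit_interval_derivative_bound[OF yd]) (simp_all add: linear_0[OF lin] matrix_mult_simps)
    then show ?thesis by (simp add: y0)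
  qed
  ultimately show ?thesis by (intro exI[of _ "\<lambda>z. y z 1"]) auto
qed

section \<open>The connection form in su2\<close>

lemma mk_mat2_nth [simp]:
  "mk_mat2 a b c d $ 1 $ 1 = a" "mk_mat2 a b c d $ 1 $ 2 = b"
  "mk_mat2 a b c d $ 2 $ 1 = c" "mk_mat2 a b c d $ 2 $ 2 = d"
  by (simp_all add: mk_mat2_def)

lemma mat2_eq_iff:
  fixes A B :: mat2
  shows "A = B \<longleftrightarrow> A$1$1 = B$1$1 \<and> A$1$2 = B$1$2 \<and> A$2$1 = B$2$1 \<and> A$2$2 = B$2$2"
  by (auto simp: vec_eq_iff forall_2)

lemma mat2_mult_nth: "((A :: mat2) ** B) $ i $ j = A$i$1 * B$1$j + A$i$2 * B$2$j"
  by (simp add: matrix_matrix_mult_def sum_2)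

text \<open>Real-linear coordinates of \<open>su2\<close> in which \<open>su2_form\<close> is the
  standard inner product of the real line times the complex plane and \<open>sigma3\<close> is the
  first basis vector.\<close>

definition su2_mat :: "real \<Rightarrow> complex \<Rightarrow> mat2"
  where "su2_mat a b = mk_mat2 (\<i> * of_real a) (\<i> * b) (\<i> * cnj b) (- \<i> * of_real a)"

lemma bounded_linear_su2_mat: "bounded_linear (\<lambda>p. su2_mat (fst p) (snd p))"
  by (rule linear_conv_bounded_linear[THEN iffD1])
    (auto intro!: linearI simp: su2_mat_def mat2_eq_iff algebra_simps scaleR_conv_of_real[where 'a=complex])

lemma su2_mat_add: "su2_mat a b + su2_mat c d = su2_mat (a + c) (b + d)"
  by (simp add: su2_mat_def mat2_eq_iff algebra_simps)

lemma su2_mat_diff: "su2_mat a b - su2_mat c d = su2_mat (a - c) (b - d)"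
  by (simp add: su2_mat_def mat2_eq_iff algebra_simps)

lemma scaleR_su2_mat: "r *\<^sub>R su2_mat a b = su2_mat (r * a) (of_real r * b)"
  by (simp add: su2_mat_def mat2_eq_iff algebra_simps scaleR_conv_of_real[where 'a=complex])

lemma cadj_su2_mat: "cadj (su2_mat a b) = - su2_mat a b"
  by (simp add: su2_mat_def mat2_eq_iff cadj_nth)

lemma su2_mat_commutator:
  "su2_mat a b ** su2_mat c d - su2_mat c d ** su2_mat a b =
    su2_mat (- 2 * Im (b * cnj d)) (- 2 * \<i> * (b * of_real c - of_real a * d))"
  by (simp add: su2_mat_def mat2_eq_iff mat2_mult_nth complex_eq_iff algebra_simps)

lemma su2_form_su2_mat: "su2_form (su2_mat a b) (su2_mat c d) = of_real (a * c + Re (b * cnj d))"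
  by (simp add: su2_form_def trace_def sum_2 su2_mat_def mat2_mult_nth complex_eq_iff) (simp add: field_simps)

lemma sigma3_su2_mat: "sigma3 = su2_mat 1 0"
  by (simp add: sigma3_def su2_mat_def)

lemma su2_form_add_left: "su2_form (A + B) C = su2_form A C + su2_form B C"
  by (simp add: su2_form_def matrix_mult_simps trace_add algebra_simps)

lemma su2_form_zero_left: "su2_form 0 C = 0"
  by (simp add: su2_form_def matrix_mult_simps trace_def)

lemma su2_form_scaleR_left: "su2_form (r *\<^sub>R A) C = of_real r * su2_form A C"
  by (simp add: su2_form_def matrix_mult_simps trace_def sum_2 scaleR_conv_of_real[where 'a=complex] algebra_simps)

text \<open>Cyclicity of the trace makes the form invariant under conjugation by unitary matrices,
  so the frame drops out of the metric and the Hopf differential.\<close>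

lemma su2_form_conj:
  assumes "cadj F ** F = mat 1"
  shows "su2_form (F ** A ** cadj F) (F ** B ** cadj F) = su2_form A B"
proof -
  have "X ** cadj F ** F = X" for X :: mat2
    by (simp add: assms flip: matrix_mul_assoc)
  then have "trace (F ** A ** cadj F ** (F ** B ** cadj F)) = trace (F ** A ** B ** cadj F)"
    by (simp add: matrix_mul_assoc)
  also have "\<dots> = trace (cadj F ** (F ** A ** B))"
    by (rule trace_mul_sym)
  also have "\<dots> = trace (A ** B)"
    by (simp add: matrix_mul_assoc assms)
  finally show ?thesis
    by (simp add: su2_form_def)
qed

lemma matrix_inv_eq_cadj:
  fixes F :: "complex^'n^'n"
  assumes "F ** cadj F = mat 1"
  shows "matrix_inv F = cadj F"
proof -
  have "F ** matrix_inv F = mat 1 \<and> matrix_inv F ** F = mat 1"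
    unfolding matrix_inv_def
    by (rule someI[where x="cadj F"]) (use assms matrix_left_right_inverse in blast)
  then show ?thesis
    by (metis assms matrix_mul_assoc matrix_mul_lid matrix_mul_rid)
qed

text \<open>Skewness of b turns the derivative of the adjoint into the right-hand half of a
  commutator. Constant M gives the first derivative of the sphere component, varying M the
  second.\<close>

lemma conj_has_derivative:
  assumes "(F has_derivative (\<lambda>v. F z ** b v)) (at z)" and "\<And>v. cadj (b v) = - b v"
    and "(M has_derivative M') (at z)"
  shows "((\<lambda>z. F z ** M z ** cadj (F z)) has_derivative
    (\<lambda>v. F z ** (b v ** M z - M z ** b v + M' v) ** cadj (F z))) (at z)"
  by (rule has_derivative_eq_rhs[OF bounded_bilinear.FDERIV[OF bounded_bilinear_matrix_mult
        bounded_bilinear.FDERIV[OF bounded_bilinear_matrix_mult assms(1,3)]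
        bounded_linear.has_derivative[OF bounded_linear_cadj assms(1)]]])
    (simp add: cadj_mult assms(2) matrix_mult_simps matrix_mul_assoc fun_eq_iff)

section \<open>Coefficients and flatness of the connection form\<close>

lemma inverse_eq_cnj: "cmod z = 1 \<Longrightarrow> inverse z = cnj z"
  using complex_norm_square[of z] by (intro inverse_unique) simp

text \<open>For \<open>p = \<delta> / \<lambda>\<close> and \<open>q = cnj \<gamma>\<close> the form \<open>\<alpha>\<close> is \<open>su2_mat (conn_a \<omega> z v) (conn_b \<omega> p q z v)\<close>.
  In \<open>dconn_a\<close> and \<open>dconn_b\<close> the argument \<open>u\<close> is the direction of differentiation.\<close>

definition conn_a :: "(complex \<Rightarrow> real) \<Rightarrow> complex \<Rightarrow> complex \<Rightarrow> real"
  where "conn_a \<omega> z v = (Im v / 2) * dir_deriv 1 \<omega> z - (Re v / 2) * dir_deriv \<i> \<omega> z"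

definition conn_b :: "(complex \<Rightarrow> real) \<Rightarrow> complex \<Rightarrow> complex \<Rightarrow> complex \<Rightarrow> complex \<Rightarrow> complex"
  where "conn_b \<omega> p q z v = exp (\<omega> z) *\<^sub>R (v * p / 4) + exp (- \<omega> z) *\<^sub>R (cnj v * q / 4)"

definition dconn_a :: "(complex \<Rightarrow> real) \<Rightarrow> complex \<Rightarrow> complex \<Rightarrow> complex \<Rightarrow> real"
  where "dconn_a \<omega> z u v = (Im v / 2) * dir_deriv u (dir_deriv 1 \<omega>) z - (Re v / 2) * dir_deriv u (dir_deriv \<i> \<omega>) z"

definition dconn_b :: "(complex \<Rightarrow> real) \<Rightarrow> complex \<Rightarrow> complex \<Rightarrow> complex \<Rightarrow> complex \<Rightarrow> complex \<Rightarrow> complex"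
  where "dconn_b \<omega> p q z u v =
    dir_deriv u \<omega> z *\<^sub>R (exp (\<omega> z) *\<^sub>R (v * p / 4) - exp (- \<omega> z) *\<^sub>R (cnj v * q / 4))"

text \<open>On the unit circle the conjugate of 1/\<lambda> is \<lambda>, which pairs the
  off-diagonal entries as \<open>su2\<close> requires. The diagonal is a difference of complex
  conjugates because \<omega> is real, hence imaginary.\<close>

lemma alpha_su2_mat:
  assumes "\<omega> differentiable (at z)" and "cmod lam = 1"
  shows "alpha \<omega> \<delta> \<gamma> lam z v = su2_mat (conn_a \<omega> z v) (conn_b \<omega> (inverse lam * \<delta>) (cnj \<gamma>) z v)"
proof -
  have "dir_deriv u (\<lambda>w. complex_of_real (\<omega> w)) z = of_real (dir_deriv u \<omega> z)" for u
    by (rule dir_deriv_bounded_linear[OF bounded_linear_of_real assms(1)])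
  moreover have "cnj (inverse lam) = lam"
    by (simp add: inverse_eq_cnj[OF assms(2)])
  ultimately show ?thesis
    by (simp add: alpha_def alpha_dz_def alpha_dzbar_def Let_def deriv_z_def deriv_zbar_def mat2_eq_iff
        su2_mat_def cscale_def map_matrix_def conn_a_def conn_b_def scaleR_conv_of_real[where 'a=complex])
      (simp add: complex_eq_iff field_simps)
qed

lemma
  assumes "smooth \<omega>"
  shows conn_a_has_derivative: "((\<lambda>z. conn_a \<omega> z v) has_derivative (\<lambda>u. dconn_a \<omega> z u v)) (at z)"
    and conn_b_has_derivative: "((\<lambda>z. conn_b \<omega> p q z v) has_derivative (\<lambda>u. dconn_b \<omega> p q z u v)) (at z)"
proof -
  have k: "k_smooth (Suc (Suc 0)) \<omega>"
    using assms unfolding smooth_def by blast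
  have d0: "(\<omega> has_derivative (\<lambda>u. dir_deriv u \<omega> z)) (at z)"
    by (rule k_smooth_Suc_has_derivative[OF k])
  have d1: "(dir_deriv w \<omega> has_derivative (\<lambda>u. dir_deriv u (dir_deriv w \<omega>) z)) (at z)" for w
    by (rule k_smooth_Suc_has_derivative[OF k_smooth_dir_deriv[OF k]])
  show "((\<lambda>z. conn_a \<omega> z v) has_derivative (\<lambda>u. dconn_a \<omega> z u v)) (at z)"
    unfolding conn_a_def dconn_a_def
    by (intro has_derivative_diff has_derivative_mult_right d1)
  have "((\<lambda>z. exp (\<omega> z) *\<^sub>R (v * p / 4)) has_derivative (\<lambda>u. (dir_deriv u \<omega> z * exp (\<omega> z)) *\<^sub>R (v * p / 4))) (at z)"
    by (rule has_derivative_scaleR_left) (rule has_derivative_eq_rhs[OF has_derivative_exp[OF d0]], simp add: mult.commute)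
  moreover have "((\<lambda>z. exp (- \<omega> z) *\<^sub>R (cnj v * q / 4)) has_derivative
      (\<lambda>u. (- dir_deriv u \<omega> z * exp (- \<omega> z)) *\<^sub>R (cnj v * q / 4))) (at z)"
    by (rule has_derivative_scaleR_left)
      (rule has_derivative_eq_rhs[OF has_derivative_exp[OF has_derivative_minus[OF d0]]], simp add: mult.commute)
  ultimately have "((\<lambda>z. conn_b \<omega> p q z v) has_derivative (\<lambda>u.
      (dir_deriv u \<omega> z * exp (\<omega> z)) *\<^sub>R (v * p / 4) + (- dir_deriv u \<omega> z * exp (- \<omega> z)) *\<^sub>R (cnj v * q / 4))) (at z)"
    unfolding conn_b_def by (rule has_derivative_add)
  then show "((\<lambda>z. conn_b \<omega> p q z v) has_derivative (\<lambda>u. dconn_b \<omega> p q z u v)) (at z)"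
    by (rule has_derivative_eq_rhs) (simp add: dconn_b_def scaleR_diff_right)
qed

lemma su2_mat_has_derivative:
  assumes "(a has_derivative a') (at z within S)" and "(b has_derivative b') (at z within S)"
  shows "((\<lambda>z. su2_mat (a z) (b z)) has_derivative (\<lambda>v. su2_mat (a' v) (b' v))) (at z within S)"
  using bounded_linear.has_derivative[OF bounded_linear_su2_mat has_derivative_Pair[OF assms]] by simp

lemma conn_smooth:
  assumes "smooth \<omega>"
  shows "k_smooth k (\<lambda>z. su2_mat (conn_a \<omega> z v) (conn_b \<omega> p q z v))"
proof -
  have \<omega>: "k_smooth k \<omega>" "k_smooth k (dir_deriv u \<omega>)" for u
    using assms unfolding smooth_def by (blast intro: k_smooth_dir_deriv)+
  have "k_smooth k (\<lambda>z. (Im v / 2) * dir_deriv 1 \<omega> z + (- Re v / 2) * dir_deriv \<i> \<omega> z)"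
    by (rule k_smooth_add; rule k_smooth_bounded_linear[OF bounded_linear_mult_right]; rule \<omega>)
  moreover have "k_smooth k (\<lambda>z. exp (\<omega> z) *\<^sub>R (v * p / 4) + exp (- \<omega> z) *\<^sub>R (cnj v * q / 4))"
    by (rule k_smooth_add; rule k_smooth_bounded_linear[OF bounded_linear_scaleR_left]; rule k_smooth_exp)
      (rule \<omega> k_smooth_bounded_linear[OF bounded_linear_minus[OF bounded_linear_ident]])+
  ultimately have "k_smooth k (\<lambda>z. (conn_a \<omega> z v, conn_b \<omega> p q z v))"
    unfolding conn_a_def conn_b_def by (intro k_smooth_Pair) simp_all
  from k_smooth_bounded_linear[OF bounded_linear_su2_mat this] show ?thesis by simp
qed

lemma dir_deriv_complex:
  assumes "f differentiable (at z)"
  shows "dir_deriv u f z = Re u *\<^sub>R dir_deriv 1 f z + Im u *\<^sub>R dir_deriv \<i> f z"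
proof -
  have lin: "linear (\<lambda>v. dir_deriv v f z)"
    by (rule has_derivative_linear[OF has_derivative_dir_deriv[OF assms]])
  have "u = Re u *\<^sub>R 1 + Im u *\<^sub>R \<i>"
    by (simp add: complex_eq_iff)
  show ?thesis
    by (subst \<open>u = _\<close>) (simp only: linear_add[OF lin] linear_scale[OF lin])
qed

lemma cosh_sinh_double:
  fixes x :: real
  shows "exp x * exp x = cosh (2 * x) + sinh (2 * x)" "exp (- x) * exp (- x) = cosh (2 * x) - sinh (2 * x)"
  by (simp_all add: cosh_plus_sinh cosh_minus_sinh flip: exp_add)

text \<open>In the mixed terms the exponentials cancel. What they leave does not involve \<omega>,
  which is why the Hopf coefficient is constant in z.\<close>

lemma conn_b_mult_cnj:
  "conn_b \<omega> p q z u * cnj (conn_b \<omega> p q z v) = (1 / 16) *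
    (of_real (exp (\<omega> z) * exp (\<omega> z)) * (u * cnj v * (p * cnj p))
     + of_real (exp (- \<omega> z) * exp (- \<omega> z)) * (cnj u * v * (q * cnj q))
     + u * v * (p * cnj q) + cnj (u * v * (p * cnj q)))"
proof -
  have e: "of_real (exp (\<omega> z)) * of_real (exp (- \<omega> z)) = (1 :: complex)"
    by (simp flip: of_real_mult exp_add)
  have "conn_b \<omega> p q z u * cnj (conn_b \<omega> p q z v) = (1 / 16) *
    (of_real (exp (\<omega> z) * exp (\<omega> z)) * (u * cnj v * (p * cnj p))
     + of_real (exp (- \<omega> z) * exp (- \<omega> z)) * (cnj u * v * (q * cnj q))
     + (of_real (exp (\<omega> z)) * of_real (exp (- \<omega> z))) * (u * v * (p * cnj q) + cnj (u * v * (p * cnj q))))"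
    by (simp add: conn_b_def scaleR_conv_of_real[where 'a=complex] algebra_simps del: of_real_exp)
  then show ?thesis by (simp only: e mult_1 add.assoc)
qed

text \<open>The unmixed terms are conjugate to each other up to the weights
  \<open>exp (2 * \<omega> z)\<close> and \<open>exp (- 2 * \<omega> z)\<close>: the real part
  collects cosh, the imaginary part sinh. The real part governs metric and Hopf differential, the
  imaginary part the curvature.\<close>

lemma
  assumes "p * cnj p = 1" and "q * cnj q = 1"
  shows Re_conn_b_mult_cnj: "Re (conn_b \<omega> p q z u * cnj (conn_b \<omega> p q z v)) =
      (cosh (2 * \<omega> z) * Re (u * cnj v) + Re (u * v * (p * cnj q))) / 8"
    and Im_conn_b_mult_cnj: "Im (conn_b \<omega> p q z u * cnj (conn_b \<omega> p q z v)) =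
      sinh (2 * \<omega> z) * Im (u * cnj v) / 8"
proof -
  define w where "w = u * v * (p * cnj q)"
  have *: "conn_b \<omega> p q z u * cnj (conn_b \<omega> p q z v) = (1 / 16) *
    (of_real (cosh (2 * \<omega> z) + sinh (2 * \<omega> z)) * (u * cnj v)
     + of_real (cosh (2 * \<omega> z) - sinh (2 * \<omega> z)) * (cnj u * v) + w + cnj w)"
    unfolding conn_b_mult_cnj assms cosh_sinh_double w_def by simp
  show "Re (conn_b \<omega> p q z u * cnj (conn_b \<omega> p q z v)) =
      (cosh (2 * \<omega> z) * Re (u * cnj v) + Re (u * v * (p * cnj q))) / 8"
    unfolding * w_def[symmetric] by (simp add: field_simps)
  show "Im (conn_b \<omega> p q z u * cnj (conn_b \<omega> p q z v)) = sinh (2 * \<omega> z) * Im (u * cnj v) / 8"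
    unfolding * by (simp add: field_simps)
qed

lemma conn_linear: "linear (\<lambda>v. su2_mat (conn_a \<omega> z v) (conn_b \<omega> p q z v))"
proof -
  have "linear (\<lambda>v. (conn_a \<omega> z v, conn_b \<omega> p q z v))"
    by (rule linearI) (simp_all add: conn_a_def conn_b_def algebra_simps scaleR_conv_of_real[where 'a=complex] add_divide_distrib)
  from linear_compose[OF this bounded_linear.linear[OF bounded_linear_su2_mat]] show ?thesis
    by (simp add: o_def)
qed

text \<open>The real coordinate of flatness is the sinh-Gordon equation. The complex coordinate is
  the identity obtained by differentiating the two exponentials.\<close>

lemma conn_flat:
  assumes sm: "smooth \<omega>" and sG: "sinh_Gordon \<omega>" and p: "p * cnj p = 1" and q: "q * cnj q = 1"
  defines "\<beta> \<equiv> \<lambda>z v. su2_mat (conn_a \<omega> z v) (conn_b \<omega> p q z v)"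
    and "d\<beta> \<equiv> \<lambda>z u v. su2_mat (dconn_a \<omega> z u v) (dconn_b \<omega> p q z u v)"
  shows "d\<beta> z u v - d\<beta> z v u = \<beta> z v ** \<beta> z u - \<beta> z u ** \<beta> z v"
proof -
  have k: "k_smooth (Suc (Suc 0)) \<omega>"
    using sm unfolding smooth_def by blast
  have d0: "dir_deriv u \<omega> z = Re u * dir_deriv 1 \<omega> z + Im u * dir_deriv \<i> \<omega> z" for u
    using dir_deriv_complex[of \<omega> z u] k by simp
  have d1: "dir_deriv u (dir_deriv w \<omega>) z =
      Re u * dir_deriv 1 (dir_deriv w \<omega>) z + Im u * dir_deriv \<i> (dir_deriv w \<omega>) z" for u w
    using dir_deriv_complex[of "dir_deriv w \<omega>" z u] k by simp
  \<comment> \<open>Under antisymmetrization in u and v each mixed second derivative cancels against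
    itself, and the pure ones combine to the Laplacian.\<close>
  have "dconn_a \<omega> z u v - dconn_a \<omega> z v u = Im (v * cnj u) / 2 * laplacian \<omega> z"
    unfolding dconn_a_def d1[of u] d1[of v] laplacian_def by (simp add: field_simps)
  also have "laplacian \<omega> z = - sinh (\<omega> z) * cosh (\<omega> z)"
    using sG by (simp add: sinh_Gordon_def eq_neg_iff_add_eq_0)
  also have "Im (v * cnj u) / 2 * (- sinh (\<omega> z) * cosh (\<omega> z)) =
      - 2 * Im (conn_b \<omega> p q z v * cnj (conn_b \<omega> p q z u))"
    unfolding Im_conn_b_mult_cnj[OF p q] sinh_double by simp
  finally have a: "dconn_a \<omega> z u v - dconn_a \<omega> z v u = \<dots>" .
  have b: "dconn_b \<omega> p q z u v - dconn_b \<omega> p q z v u =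
      - 2 * \<i> * (conn_b \<omega> p q z v * of_real (conn_a \<omega> z u) - of_real (conn_a \<omega> z v) * conn_b \<omega> p q z u)"
    unfolding dconn_b_def d0[of u] d0[of v] conn_b_def conn_a_def
    by (simp add: complex_eq_iff) (simp add: field_simps)
  show ?thesis
    unfolding \<beta>_def d\<beta>_def su2_mat_commutator su2_mat_diff a b ..
qed

section \<open>The surface of an extended frame\<close>

text \<open>Here p stands for \<delta>/\<lambda> and q for the conjugate of \<gamma>, so
  \<open>s_square\<close> says that s is a square root of \<gamma>\<delta>/\<lambda>.\<close>

locale extended_frame =
  fixes \<omega> :: "complex \<Rightarrow> real" and p q s :: complex and F :: "complex \<Rightarrow> mat2"
  assumes smooth: "smooth \<omega>" and unit_p: "p * cnj p = 1" and unit_q: "q * cnj q = 1"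
    and s_square: "s\<^sup>2 = p * cnj q"
    and F_0: "F 0 = mat 1"
    and F_deriv: "(F has_derivative (\<lambda>v. F z ** su2_mat (conn_a \<omega> z v) (conn_b \<omega> p q z v))) (at z)"
begin

lemma unitary: "F z ** cadj (F z) = mat 1"
  by (rule unitary_product[OF F_deriv F_deriv cadj_su2_mat F_0 F_0])

lemma unitary': "cadj (F z) ** F z = mat 1"
  using unitary matrix_left_right_inverse by blast

text \<open>Bootstrapping: the derivative is F times smooth coefficients, so each order of
  smoothness of F yields the next.\<close>

lemma F_smooth: "k_smooth k F"
proof (induction k)
  case 0
  show ?case
    by (simp add: continuous_on_eq_continuous_within has_derivative_continuous[OF F_deriv])
next
  case (Suc k)
  show ?case
    by (rule k_smooth_SucI[OF F_deriv])
      (rule k_smooth_bounded_bilinear[OF bounded_bilinear_matrix_mult Suc.IH conn_smooth[OF smooth]])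
qed

section \<open>The sphere component and its derivatives\<close>

definition G :: "complex \<Rightarrow> mat2"
  where "G z = F z ** sigma3 ** cadj (F z)"

definition dG :: "complex \<Rightarrow> complex \<Rightarrow> mat2"
  where "dG v z = F z ** su2_mat 0 (- 2 * \<i> * conn_b \<omega> p q z v) ** cadj (F z)"

text \<open>The first coordinate is the part along G, and it equals minus the inner product of
  \<open>dG u z\<close> and \<open>dG v z\<close>, as on any unit sphere. The second coordinate is
  the tangential part.\<close>

definition ddG :: "complex \<Rightarrow> complex \<Rightarrow> complex \<Rightarrow> mat2"
  where "ddG u v z = F z ** su2_mat (- 4 * Re (conn_b \<omega> p q z u * cnj (conn_b \<omega> p q z v)))
    (4 * of_real (conn_a \<omega> z u) * conn_b \<omega> p q z v - 2 * \<i> * dconn_b \<omega> p q z u v) ** cadj (F z)"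

lemma G_has_derivative: "(G has_derivative (\<lambda>v. dG v z)) (at z)"
  unfolding G_def dG_def
  by (rule has_derivative_eq_rhs[OF conj_has_derivative[OF F_deriv cadj_su2_mat has_derivative_const]])
    (simp add: sigma3_su2_mat su2_mat_commutator)

lemma dG_has_derivative: "(dG v has_derivative (\<lambda>u. ddG u v z)) (at z)"
  unfolding dG_def ddG_def
  by (rule has_derivative_eq_rhs[OF conj_has_derivative[OF F_deriv cadj_su2_mat
        su2_mat_has_derivative[OF has_derivative_const
          has_derivative_mult_right[OF conn_b_has_derivative[OF smooth]]]]])
    (simp add: su2_mat_commutator su2_mat_add algebra_simps)

lemma su2_form_dG:
  "su2_form (dG u z) (dG v z) =
    of_real ((cosh (2 * \<omega> z) * Re (u * cnj v) + Re (u * v * s\<^sup>2)) / 2)"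
proof -
  have "su2_form (dG u z) (dG v z) = of_real (4 * Re (conn_b \<omega> p q z u * cnj (conn_b \<omega> p q z v)))"
    unfolding dG_def su2_form_conj[OF unitary'] su2_form_su2_mat by (simp add: algebra_simps)
  also have "4 * Re (conn_b \<omega> p q z u * cnj (conn_b \<omega> p q z v)) =
      (cosh (2 * \<omega> z) * Re (u * cnj v) + Re (u * v * s\<^sup>2)) / 2"
    unfolding Re_conn_b_mult_cnj[OF unit_p unit_q] s_square by simp
  finally show ?thesis .
qed

text \<open>The tangential parts for the directions 1 and \<open>\<i>\<close> cancel. A Laplacian
  that is radial means that G is a harmonic map into the sphere.\<close>

lemma harmonic: "\<exists>r. ddG 1 1 z + ddG \<i> \<i> z = r *\<^sub>R G z"
proof -
  define c where "c u = - 4 * Re (conn_b \<omega> p q z u * cnj (conn_b \<omega> p q z u))" for u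
  have "4 * of_real (conn_a \<omega> z 1) * conn_b \<omega> p q z 1 - 2 * \<i> * dconn_b \<omega> p q z 1 1
      + (4 * of_real (conn_a \<omega> z \<i>) * conn_b \<omega> p q z \<i> - 2 * \<i> * dconn_b \<omega> p q z \<i> \<i>) = 0"
    by (simp add: conn_a_def conn_b_def dconn_b_def scaleR_conv_of_real[where 'a=complex] algebra_simps
        del: of_real_exp)
  then have "ddG 1 1 z + ddG \<i> \<i> z = F z ** su2_mat (c 1 + c \<i>) 0 ** cadj (F z)"
    unfolding ddG_def by (simp add: c_def su2_mat_add flip: matrix_mult_simps(1,2))
  also have "su2_mat (c 1 + c \<i>) 0 = (c 1 + c \<i>) *\<^sub>R sigma3"
    by (simp add: sigma3_su2_mat scaleR_su2_mat)
  finally show ?thesis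
    unfolding G_def by (auto simp: matrix_mult_simps)
qed

lemma G_in_S2: "G z \<in> S2"
proof -
  have "cadj (G z) = - G z"
    by (simp add: G_def cadj_mult sigma3_su2_mat cadj_su2_mat matrix_mult_simps matrix_mul_assoc)
  moreover have "trace (G z) = trace (cadj (F z) ** (F z ** sigma3))"
    unfolding G_def by (rule trace_mul_sym)
  then have "trace (G z) = 0"
    by (simp add: matrix_mul_assoc unitary' trace_def sum_2 sigma3_def)
  moreover have "det (G z) = det (F z ** cadj (F z)) * det sigma3"
    by (simp add: G_def det_mul)
  then have "det (G z) = 1"
    by (simp add: unitary det_I det_2[of sigma3]) (simp add: sigma3_def)
  ultimately show ?thesis
    by (simp add: S2_def su2_def cadj_def)
qed

section \<open>The immersion into the product\<close>

abbreviation X :: "complex \<Rightarrow> ambient"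
  where "X \<equiv> associated_surface F s"

text \<open>Unitarity replaces the inverse by the adjoint, a real-linear operation that is
  differentiated directly.\<close>

lemma X_eq: "X z = (G z, Re (- \<i> * s * z))"
  by (simp add: associated_surface_def G_def matrix_inv_eq_cadj[OF unitary])

lemma dir_deriv_X: "dir_deriv v X = (\<lambda>z. (dG v z, Re (- \<i> * s * v)))"
proof
  fix z
  have "((\<lambda>z. Re (- \<i> * s * z)) has_derivative (\<lambda>v. Re (- \<i> * s * v))) (at z)"
    by (intro bounded_linear_imp_has_derivative bounded_linear_compose[OF bounded_linear_Re] bounded_linear_mult_right)
  from has_derivative_Pair[OF G_has_derivative this]
  have "(X has_derivative (\<lambda>v. (dG v z, Re (- \<i> * s * v)))) (at z)"
    by (simp only: X_eq[abs_def])
  then show "dir_deriv v X z = (dG v z, Re (- \<i> * s * v))"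
    by (rule dir_deriv_eq)
qed

lemma dir_deriv_dir_deriv_X: "dir_deriv u (dir_deriv v X) z = (ddG u v z, 0)"
  unfolding dir_deriv_X
  by (rule dir_deriv_eq[OF has_derivative_Pair[OF dG_has_derivative has_derivative_const]])

lemma X_smooth: "k_smooth k X"
proof -
  have "k_smooth k (\<lambda>z. F z ** sigma3 ** cadj (F z))"
    by (intro k_smooth_bounded_bilinear[OF bounded_bilinear_matrix_mult] F_smooth k_smooth_const
        k_smooth_bounded_linear[OF bounded_linear_cadj])
  moreover have "k_smooth k (\<lambda>z. Re (- \<i> * s * z))"
    by (rule k_smooth_bounded_linear[OF bounded_linear_compose[OF bounded_linear_Re bounded_linear_mult_right]
          k_smooth_ident])
  ultimately show ?thesis
    unfolding X_eq[abs_def] G_def by (rule k_smooth_Pair)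
qed

text \<open>The height contributes a term that cancels the Hopf part of the metric of G and adds
  half the flat metric; then cosh(2\<omega>) + 1 is twice the square of cosh \<omega>.\<close>

lemma first_form_X: "first_form X z u v = (cosh (\<omega> z))\<^sup>2 * Re (u * cnj v)"
proof -
  \<comment> \<open>This is 2 Re a Re b = Re (a b) + Re (a \<open>cnj b\<close>) for a = -isu and b
    = -isv, where a b = -uv\<open>s\<^sup>2\<close>.\<close>
  have "Re (u * v * s\<^sup>2) + 2 * (Re (- \<i> * s * u) * Re (- \<i> * s * v)) = Re ((s * cnj s) * (u * cnj v))"
    by (simp add: power2_eq_square algebra_simps)
  also have "s * cnj s = 1"
  proof -
    have "cmod p = 1" "cmod q = 1"
      using unit_p unit_q by (metis complex_mod_mult_cnj norm_one power2_eq_1_iff norm_ge_zero neg_0_le_iff_le not_one_le_zero)+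
    moreover have "(cmod s)\<^sup>2 = cmod p * cmod q"
      using s_square by (metis complex_mod_cnj norm_mult norm_power)
    ultimately show ?thesis
      by (simp flip: complex_norm_square)
  qed
  finally have "Re (u * v * s\<^sup>2) + 2 * (Re (- \<i> * s * u) * Re (- \<i> * s * v)) = Re (u * cnj v)"
    by simp
  then have "first_form X z u v = (cosh (2 * \<omega> z) + 1) / 2 * Re (u * cnj v)"
    unfolding first_form_def dir_deriv_X ambient_inner_def fst_conv snd_conv su2_form_dG Re_complex_of_real
    by (simp add: field_simps)
  also have "cosh (2 * \<omega> z) + 1 = 2 * (cosh (\<omega> z))\<^sup>2"
    by (simp add: cosh_double sinh_square_eq)
  finally show ?thesis by simp
qed

text \<open>By conformality the mean curvature is a multiple of the trace of the second form, that
  is, of the Laplacian of X paired with N. This Laplacian is a multiple of G with no height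
  component, and N is orthogonal to G.\<close>

lemma X_minimal: "minimal X"
  unfolding minimal_def
proof (intro allI impI)
  fix z N assume "unit_normal X z N"
  then have N: "su2_form (G z) (fst N) = 0"
    by (simp add: unit_normal_def tangent_S2xR_def X_eq)
  obtain r where r: "ddG 1 1 z + ddG \<i> \<i> z = r *\<^sub>R G z"
    using harmonic by blast
  have "second_form X z N 1 1 + second_form X z N \<i> \<i> = Re (su2_form (ddG 1 1 z + ddG \<i> \<i> z) (fst N))"
    by (simp add: second_form_def dir_deriv_dir_deriv_X ambient_inner_def su2_form_add_left)
  also have "\<dots> = 0"
    by (simp add: r su2_form_scaleR_left N)
  finally have "(cosh (\<omega> z))\<^sup>2 * second_form X z N 1 1 + (cosh (\<omega> z))\<^sup>2 * second_form X z N \<i> \<i> = 0"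
    by (simp flip: distrib_left)
  then show "mean_curvature X z N = 0"
    by (simp add: mean_curvature_def first_form_X)
qed

lemma X_immersion: "immersion_S2xR X"
  unfolding immersion_S2xR_def
proof (intro conjI allI)
  show "Defs.smooth X"
    by (simp add: smooth_def X_smooth)
  show "range X \<subseteq> S2xR"
    using G_in_S2 by (auto simp: S2xR_def X_eq)
  fix z
  have lin: "linear (frechet_derivative X (at z))"
    using X_smooth[of "Suc 0"] by (intro linear_frechet_derivative) simp
  show "inj (frechet_derivative X (at z))"
    unfolding linear_injective_0[OF lin]
  proof (intro allI impI)
    \<comment> \<open>A kernel vector has length zero in a metric whose factor cosh never
      vanishes.\<close>
    fix v assume "frechet_derivative X (at z) v = 0"
    then have "first_form X z v v = 0"
      by (simp add: first_form_def dir_deriv_def ambient_inner_def su2_form_zero_left)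
    then show "v = 0"
      by (simp add: first_form_X complex_eq_iff flip: power2_eq_square)
  qed
qed

lemma X_conformal: "conformal X"
  unfolding conformal_def first_form_X inner_complex_def
  by (auto intro!: exI[of _ "(cosh (\<omega> z))\<^sup>2" for z])

text \<open>Expanding the form on \<open>dG 1 z\<close> minus \<open>\<i>\<close> times
  \<open>dG \<i> z\<close>, the cosh terms cancel; the differences left are the real part of
  \<open>s\<^sup>2\<close> and \<open>\<i>\<close> times its imaginary part.\<close>

lemma Hopf_coeff_X: "Hopf_coeff X z = s\<^sup>2 / 4"
proof -
  define M where "M = matrix_deriv_z (\<lambda>w. fst (X w)) z"
  have entry: "dir_deriv v (\<lambda>w. G w $ i $ j) z = dG v z $ i $ j" for v i j
    by (rule dir_deriv_eq)
      (intro bounded_linear.has_derivative[OF bounded_linear_compose[OF bounded_linear_vec_nth bounded_linear_vec_nth]]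
        G_has_derivative)
  have M: "M $ i $ j = (dG 1 z $ i $ j - \<i> * dG \<i> z $ i $ j) / 2" for i j
    by (simp add: M_def matrix_deriv_z_def deriv_z_def X_eq entry)
  have "su2_form M M = (su2_form (dG 1 z) (dG 1 z) - 2 * \<i> * su2_form (dG 1 z) (dG \<i> z)
      - su2_form (dG \<i> z) (dG \<i> z)) / 4"
    by (simp add: su2_form_def trace_def sum_2 mat2_mult_nth M) (simp add: field_simps)
  also have "\<dots> = s\<^sup>2 / 4"
    unfolding su2_form_dG by (simp add: complex_eq_iff field_simps)
  finally show ?thesis
    by (simp add: Hopf_coeff_def M_def Let_def)
qed

end

section \<open>Existence and uniqueness of the frame, and the associated family\<close>

theorem theorem1p3:
  fixes \<omega> :: "complex \<Rightarrow> real" and \<delta> \<gamma> :: complex and s :: "complex \<Rightarrow> complex"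
  assumes "smooth \<omega>" and "sinh_Gordon \<omega>"
    and "\<delta> \<in> sphere 0 1" and "\<gamma> \<in> sphere 0 1"
    and "\<forall>lam\<in>sphere 0 1. (s lam)\<^sup>2 = \<gamma> * \<delta> * inverse lam"
  shows "(\<forall>lam\<in>sphere 0 1. \<exists>!F. frame_solution \<omega> \<delta> \<gamma> lam F) \<and>
    (\<forall>F. (\<forall>lam\<in>sphere 0 1. frame_solution \<omega> \<delta> \<gamma> lam (F lam)) \<longrightarrow>
      (\<forall>lam\<in>sphere 0 1.
        let X = associated_surface (F lam) (s lam) in
          conformal_minimal_immersion X \<and>
          has_metric X (\<lambda>z. (cosh (\<omega> z))\<^sup>2) \<and>
          (\<forall>z. Hopf_coeff X z = 1/4 * \<gamma> * \<delta> * inverse lam)))"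
proof -
  define \<beta> where "\<beta> lam z v = su2_mat (conn_a \<omega> z v) (conn_b \<omega> (inverse lam * \<delta>) (cnj \<gamma>) z v)" for lam z v
  have p: "inverse lam * \<delta> * cnj (inverse lam * \<delta>) = 1" if "lam \<in> sphere 0 1" for lam
    using that assms(3) by (simp add: norm_mult norm_inverse del: complex_cnj_mult flip: complex_norm_square)
  have q: "cnj \<gamma> * cnj (cnj \<gamma>) = 1"
    using assms(4) by (simp del: complex_cnj_cnj flip: complex_norm_square)
  \<comment> \<open>The frame condition becomes a linear equation with skew coefficients. In the
    direction back, invertibility and the value of \<open>matrix_inv\<close> come from
    unitarity.\<close>
  have frame: "frame_solution \<omega> \<delta> \<gamma> lam F \<longleftrightarrow>
      F 0 = mat 1 \<and> (\<forall>z. (F has_derivative (\<lambda>v. F z ** \<beta> lam z v)) (at z))"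
    if lam: "lam \<in> sphere 0 1" for lam F
  proof -
    have "k_smooth (Suc 0) \<omega>"
      using assms(1) unfolding smooth_def by blast
    then have \<alpha>: "alpha \<omega> \<delta> \<gamma> lam z v = \<beta> lam z v" for z v
      using lam by (simp add: alpha_su2_mat \<beta>_def)
    show ?thesis
    proof
      assume fs: "frame_solution \<omega> \<delta> \<gamma> lam F"
      have "(F has_derivative (\<lambda>v. F z ** \<beta> lam z v)) (at z)" for z
      proof -
        have *: "invertible (F z)" "F differentiable (at z)" "matrix_inv (F z) ** dir_deriv v F z = \<beta> lam z v" for v
          using fs by (auto simp: frame_solution_def \<alpha>)
        have "F z ** matrix_inv (F z) = mat 1"
          using someI_ex[OF *(1)[unfolded invertible_def]] by (simp add: matrix_inv_def)
        then have "F z ** \<beta> lam z v = dir_deriv v F z" for v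
          by (simp add: matrix_mul_assoc flip: *(3))
        with has_derivative_dir_deriv[OF *(2)] show ?thesis by simp
      qed
      with fs show "F 0 = mat 1 \<and> (\<forall>z. (F has_derivative (\<lambda>v. F z ** \<beta> lam z v)) (at z))"
        by (simp add: frame_solution_def)
    next
      assume F: "F 0 = mat 1 \<and> (\<forall>z. (F has_derivative (\<lambda>v. F z ** \<beta> lam z v)) (at z))"
      then have un: "F z ** cadj (F z) = mat 1" for z
        by (intro unitary_product[of F "\<beta> lam" F]) (auto simp: \<beta>_def cadj_su2_mat)
      then have un': "cadj (F z) ** F z = mat 1" for z
        using matrix_left_right_inverse by blast
      have "invertible (F z)" for z
        unfolding invertible_def using un un' by blast
      moreover have "dir_deriv v F z = F z ** \<beta> lam z v" for v z
        using dir_deriv_eq[of F "\<lambda>v. F z ** \<beta> lam z v" z v] F by simp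
      ultimately show "frame_solution \<omega> \<delta> \<gamma> lam F"
        using F un un' by (auto simp: frame_solution_def \<alpha> matrix_inv_eq_cadj matrix_mul_assoc differentiable_def)
    qed
  qed
  show ?thesis
  proof (intro conjI allI impI ballI)
    fix lam :: complex assume lam: "lam \<in> sphere 0 1"
    show "\<exists>!F. frame_solution \<omega> \<delta> \<gamma> lam F"
    proof (rule ex_ex1I)
      define d\<beta> where "d\<beta> z u v = su2_mat (dconn_a \<omega> z u v) (dconn_b \<omega> (inverse lam * \<delta>) (cnj \<gamma>) z u v)" for z u v
      have der: "((\<lambda>z. \<beta> lam z v) has_derivative (\<lambda>u. d\<beta> z u v)) (at z)" for z v
        unfolding \<beta>_def d\<beta>_def
        by (intro su2_mat_has_derivative conn_a_has_derivative conn_b_has_derivative assms(1))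
      have "\<exists>F. F 0 = mat 1 \<and> (\<forall>z. (F has_derivative (\<lambda>v. F z ** \<beta> lam z v)) (at z))"
      proof (rule flat_skew_form_integrable[OF _ der])
        show "continuous_on UNIV (\<lambda>z. d\<beta> z u v)" for u v
        proof -
          have "dir_deriv u (\<lambda>z. \<beta> lam z v) = (\<lambda>z. d\<beta> z u v)"
            using dir_deriv_eq[OF der] by blast
          moreover have "k_smooth (Suc 0) (\<lambda>z. \<beta> lam z v)"
            unfolding \<beta>_def by (rule conn_smooth[OF assms(1)])
          ultimately show ?thesis by (metis k_smooth.simps)
        qed
        show "linear (\<beta> lam z)" for z
          unfolding \<beta>_def by (rule conn_linear)
        show "cadj (\<beta> lam z v) = - \<beta> lam z v" for z v
          unfolding \<beta>_def by (rule cadj_su2_mat)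
        show "d\<beta> z u v - d\<beta> z v u = \<beta> lam z v ** \<beta> lam z u - \<beta> lam z u ** \<beta> lam z v" for z u v
          unfolding \<beta>_def d\<beta>_def by (rule conn_flat[OF assms(1,2) p[OF lam] q])
      qed
      then show "\<exists>F. frame_solution \<omega> \<delta> \<gamma> lam F"
        by (simp add: frame[OF lam])
    next
      fix F G assume "frame_solution \<omega> \<delta> \<gamma> lam F" "frame_solution \<omega> \<delta> \<gamma> lam G"
      then have F: "F 0 = mat 1" "(F has_derivative (\<lambda>v. F z ** \<beta> lam z v)) (at z)"
        and G: "G 0 = mat 1" "(G has_derivative (\<lambda>v. G z ** \<beta> lam z v)) (at z)" for z
        by (auto simp: frame[OF lam])
      have skew: "cadj (\<beta> lam z v) = - \<beta> lam z v" for z v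
        unfolding \<beta>_def by (rule cadj_su2_mat)
      \<comment> \<open>Both F and G are inverse to the same matrix, the adjoint of G.\<close>
      have FG: "F z ** cadj (G z) = mat 1" for z
        by (rule unitary_product[OF F(2) G(2) skew F(1) G(1)])
      have GG: "G z ** cadj (G z) = mat 1" for z
        by (rule unitary_product[OF G(2) G(2) skew G(1) G(1)])
      have "F z = G z" for z
      proof -
        have "cadj (G z) ** G z = mat 1"
          using GG matrix_left_right_inverse by blast
        then show ?thesis
          by (metis FG matrix_mul_assoc matrix_mul_lid matrix_mul_rid)
      qed
      then show "F = G" ..
    qed
  next
    fix F and lam :: complex
    assume "\<forall>lam\<in>sphere 0 1. frame_solution \<omega> \<delta> \<gamma> lam (F lam)" and lam: "lam \<in> sphere 0 1"
    then have fs: "frame_solution \<omega> \<delta> \<gamma> lam (F lam)" by blast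
    \<comment> \<open>With these parameters the given square root satisfies \<open>s_square\<close>,
      and \<open>frame\<close> supplies the derivative of the frame.\<close>
    interpret extended_frame \<omega> "inverse lam * \<delta>" "cnj \<gamma>" "s lam" "F lam"
      using fs assms(1,5) lam p[OF lam] q
      by unfold_locales (auto simp: frame[OF lam] \<beta>_def)
    have "(s lam)\<^sup>2 = \<gamma> * \<delta> * inverse lam"
      using assms(5) lam by blast
    then show "let X = associated_surface (F lam) (s lam) in
          conformal_minimal_immersion X \<and>
          has_metric X (\<lambda>z. (cosh (\<omega> z))\<^sup>2) \<and>
          (\<forall>z. Hopf_coeff X z = 1/4 * \<gamma> * \<delta> * inverse lam)"
      using X_immersion X_conformal X_minimal
      by (simp add: conformal_minimal_immersion_def has_metric_def first_form_X Hopf_coeff_X)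
  qed
qed

end
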